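(* Fix integers $r,t,s\ge 0$ and integers $1\le \alpha_1<\cdots<\alpha_r$, $1\le \beta_1<\cdots<\beta_t$, $0\le\gamma_1<\cdots<\gamma_s$. For positive integers $n$ with $\alpha_r<\frac n2$, $\beta_t<\frac n2$, $\gamma_s\le n-1$ let $\Gamma_1$ and, if $n$ is even, $\Gamma_2,\Gamma_3,\Gamma_4$ be the associated bicirculant graphs on $2n$ vertices, and let $P_1,P_2,P_3,P_4$ be the associated Laurent polynomials (which do not depend on $n$), as defined in the context. Let $f_{\Gamma_i}(2n)$ be the number of rooted spanning forests of $\Gamma_i$. Then, as $n\to\infty$ (through those $n$, even in cases (2)–(4), for which the graph is defined and connected): (1) $f_{\Gamma_1}(2n)\sim A^{n}$, where $A=\exp\left(\int_0^1\log\left|P_1(e^{2\pi \mathbf i x})\right|dx\right)$ is the Mahler measure of $P_1(z)$; (2) $f_{\Gamma_2}(2n)\sim B^{\frac n2}$, where $B=\exp\left(\int_0^1\log\left|P_2(e^{2\pi \mathbf i x})P_1(e^{2\pi \mathbf i x})\right|dx\right)$ is the Mahler measure of $P_2(z)P_1(z)$; (3) $f_{\Gamma_3}(2n)\sim C^{\frac n2}$, where $C=\exp\left(\int_0^1\log\left|P_3(e^{2\pi \mathbf i x})P_1(e^{2\pi \mathbf i x})\right|dx\right)$ is the Mahler measure of $P_3(z)P_1(z)$; (4) $f_{\Gamma_4}(2n)\sim D^{\frac n2}$, where $D=\exp\left(\int_0^1\log\left|P_4(e^{2\pi \mathbf i x})P_1(e^{2\pi \mathbf i x})\right|dx\right)$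 is the Mahler measure of $P_4(z)P_1(z)$.
   Context: Bicirculant graph: for $R=-R\subseteq\mathbb Z_n\setminus\{0\}$, $T=-T\subseteq\mathbb Z_n\setminus\{0\}$, $S\subseteq\mathbb Z_n$, the simple undirected graph $BC(\mathbb Z_n;R,T,S)$ has vertex set $\{g_0: g\in\mathbb Z_n\}\sqcup\{g_1: g\in\mathbb Z_n\}$ ($2n$ vertices) and edges $\{h_0,g_0\}$ when $g-h\in R$, $\{h_1,g_1\}$ when $g-h\in T$, and $\{h_0,g_1\}$ when $g-h\in S$. The four graphs (integers reduced mod $n$): put $R=\{\pm\alpha_1,\dots,\pm\alpha_r\}$, $T=\{\pm\beta_1,\dots,\pm\beta_t\}$, $S=\{\gamma_1,\dots,\gamma_s\}$. Then $\Gamma_1=BC(\mathbb Z_n;R,T,S)$ and, for $n$ even, $\Gamma_2=BC(\mathbb Z_n;R\cup\{\frac n2\},T,S)$, $\Gamma_3=BC(\mathbb Z_n;R,T\cup\{\frac n2\},S)$, $\Gamma_4=BC(\mathbb Z_n;R\cup\{\frac n2\},T\cup\{\frac n2\},S)$. Polynomials: $\mathcal A(z)=2r+s+1-\sum_{j=1}^r(z^{\alpha_j}+z^{-\alpha_j})$, $\mathcal B(z)=2t+s+1-\sum_{j=1}^t(z^{\beta_j}+z^{-\beta_j})$, $\mathcal C(z)=-\sum_{j=1}^s z^{\gamma_j}$, and $P_1(z)=\mathcal A(z)\mathcal B(z)-\mathcal C(z^{-1})\mathcal C(z)$, $P_2(z)=(\mathcal A(z)+2)\mathcal B(z)-\mathcal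 C(z^{-1})\mathcal C(z)$, $P_3(z)=\mathcal A(z)(\mathcal B(z)+2)-\mathcal C(z^{-1})\mathcal C(z)$, $P_4(z)=(\mathcal A(z)+2)(\mathcal B(z)+2)-\mathcal C(z^{-1})\mathcal C(z)$. Mahler measure of a Laurent polynomial $P$: $M(P)=\exp\left(\int_0^1\log|P(e^{2\pi\mathbf i x})|\,dx\right)$. Rooted spanning forest of a graph $\Gamma$: an acyclic subgraph containing all vertices of $\Gamma$, together with a choice of one vertex (root) in each of its connected components. $f(n)\sim g(n)$ as $n\to\infty$ means $f(n)/g(n)\to1$; here, for every $\epsilon>0$ there is $N$ such that $|f(n)/g(n)-1|<\epsilon$ for all admissible $n\ge N$. If $r=0$ (resp. $t=0$, $s=0$), the conditions involving $\alpha_r$ (resp. $\beta_t$, $\gamma_s$) are vacuous. *)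

theory Defs
  imports "HOL-Analysis.Analysis"
begin

text \<open>Finite simple undirected graphs; edges are two-element sets of vertices.\<close>

record 'a ugraph =
  gverts :: "'a set"
  gedges :: "'a set set"

definition gadj :: "'a ugraph \<Rightarrow> ('a \<times> 'a) set" where
  "gadj G = {(u, v). {u, v} \<in> gedges G}"

definition connected_graph :: "'a ugraph \<Rightarrow> bool" where
  "connected_graph G \<longleftrightarrow> gverts G \<noteq> {} \<and> (\<forall>u\<in>gverts G. \<forall>v\<in>gverts G. (u, v) \<in> (gadj G)\<^sup>*)"

definition graph_components :: "'a ugraph \<Rightarrow> 'a set set" where
  "graph_components G = (\<lambda>v. {u \<in> gverts G. (v, u) \<in> (gadj G)\<^sup>*}) ` gverts G"

text \<open>A cycle is listed by its pairwise distinct vertices; the closing edge is the case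
  \<open>i = length vs - 1\<close>. The graphs are simple, so every cycle has length at least 3.\<close>

definition graph_cycle :: "'a ugraph \<Rightarrow> 'a list \<Rightarrow> bool" where
  "graph_cycle G vs \<longleftrightarrow> 3 \<le> length vs \<and> distinct vs \<and> set vs \<subseteq> gverts G \<and>
     (\<forall>i<length vs. {vs ! i, vs ! (Suc i mod length vs)} \<in> gedges G)"

definition acyclic_graph :: "'a ugraph \<Rightarrow> bool" where
  "acyclic_graph G \<longleftrightarrow> \<not> (\<exists>vs. graph_cycle G vs)"

text \<open>A rooted spanning forest is a pair of a subgraph and its set of roots.\<close>

definition rooted_spanning_forests :: "'a ugraph \<Rightarrow> ('a ugraph \<times> 'a set) set" where
  "rooted_spanning_forests G =
     {(H, Q). gverts H = gverts G \<and> gedges H \<subseteq> gedges G \<and> acyclic_graph H \<and>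
              Q \<subseteq> gverts H \<and> (\<forall>K\<in>graph_components H. \<exists>!q. q \<in> K \<and> q \<in> Q)}"

definition num_rooted_spanning_forests :: "'a ugraph \<Rightarrow> nat" where
  "num_rooted_spanning_forests G = card (rooted_spanning_forests G)"

text \<open>The cyclic group of order \<open>n\<close> is represented by the residues \<open>{0..<int n}\<close>, and
  \<open>Inl g\<close>, \<open>Inr g\<close> are the vertices $g_0$, $g_1$. The sets \<open>R\<close>, \<open>T\<close>, \<open>S\<close> consist of such
  residues; \<open>R\<close> and \<open>T\<close> are meant to be symmetric modulo \<open>n\<close> and not to contain \<open>0\<close>.\<close>

definition bicirculant :: "nat \<Rightarrow> int set \<Rightarrow> int set \<Rightarrow> int set \<Rightarrow> (int + int) ugraph" where
  "bicirculant n R T S =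
     \<lparr> gverts = {0..<int n} <+> {0..<int n},
       gedges =
         {{Inl h, Inl g} | h g. h \<in> {0..<int n} \<and> g \<in> {0..<int n} \<and> (g - h) mod int n \<in> R} \<union>
         {{Inr h, Inr g} | h g. h \<in> {0..<int n} \<and> g \<in> {0..<int n} \<and> (g - h) mod int n \<in> T} \<union>
         {{Inl h, Inr g} | h g. h \<in> {0..<int n} \<and> g \<in> {0..<int n} \<and> (g - h) mod int n \<in> S} \<rparr>"

text \<open>Sequences $\alpha_1, \dots, \alpha_r$ are functions used at the indices \<open>{1..r}\<close> only.\<close>

definition pm_residues :: "nat \<Rightarrow> nat \<Rightarrow> (nat \<Rightarrow> int) \<Rightarrow> int set" where
  "pm_residues n r \<alpha> = (\<Union>j\<in>{1..r}. {\<alpha> j mod int n, (- \<alpha> j) mod int n})"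

definition residues_of :: "nat \<Rightarrow> nat \<Rightarrow> (nat \<Rightarrow> int) \<Rightarrow> int set" where
  "residues_of n s \<gamma> = (\<lambda>j. \<gamma> j mod int n) ` {1..s}"

definition Gamma1 :: "nat \<Rightarrow> nat \<Rightarrow> nat \<Rightarrow> (nat \<Rightarrow> int) \<Rightarrow> (nat \<Rightarrow> int) \<Rightarrow> (nat \<Rightarrow> int) \<Rightarrow> nat \<Rightarrow> (int + int) ugraph" where
  "Gamma1 r t s \<alpha> \<beta> \<gamma> n =
     bicirculant n (pm_residues n r \<alpha>) (pm_residues n t \<beta>) (residues_of n s \<gamma>)"

text \<open>The next three graphs are only used for even \<open>n\<close>.\<close>

definition Gamma2 :: "nat \<Rightarrow> nat \<Rightarrow> nat \<Rightarrow> (nat \<Rightarrow> int) \<Rightarrow> (nat \<Rightarrow> int) \<Rightarrow> (nat \<Rightarrow> int) \<Rightarrow> nat \<Rightarrow> (int + int) ugraph" where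
  "Gamma2 r t s \<alpha> \<beta> \<gamma> n =
     bicirculant n (pm_residues n r \<alpha> \<union> {int n div 2}) (pm_residues n t \<beta>) (residues_of n s \<gamma>)"

definition Gamma3 :: "nat \<Rightarrow> nat \<Rightarrow> nat \<Rightarrow> (nat \<Rightarrow> int) \<Rightarrow> (nat \<Rightarrow> int) \<Rightarrow> (nat \<Rightarrow> int) \<Rightarrow> nat \<Rightarrow> (int + int) ugraph" where
  "Gamma3 r t s \<alpha> \<beta> \<gamma> n =
     bicirculant n (pm_residues n r \<alpha>) (pm_residues n t \<beta> \<union> {int n div 2}) (residues_of n s \<gamma>)"

definition Gamma4 :: "nat \<Rightarrow> nat \<Rightarrow> nat \<Rightarrow> (nat \<Rightarrow> int) \<Rightarrow> (nat \<Rightarrow> int) \<Rightarrow> (nat \<Rightarrow> int) \<Rightarrow> nat \<Rightarrow> (int + int) ugraph" where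
  "Gamma4 r t s \<alpha> \<beta> \<gamma> n =
     bicirculant n (pm_residues n r \<alpha> \<union> {int n div 2}) (pm_residues n t \<beta> \<union> {int n div 2})
       (residues_of n s \<gamma>)"

text \<open>The conditions $\alpha_r < n/2$, $\beta_t < n/2$, $\gamma_s \le n - 1$; each is void if the
  respective sequence is empty.\<close>

definition admissible_order :: "nat \<Rightarrow> nat \<Rightarrow> nat \<Rightarrow> (nat \<Rightarrow> int) \<Rightarrow> (nat \<Rightarrow> int) \<Rightarrow> (nat \<Rightarrow> int) \<Rightarrow> nat \<Rightarrow> bool" where
  "admissible_order r t s \<alpha> \<beta> \<gamma> n \<longleftrightarrow> 0 < n \<and>
     (0 < r \<longrightarrow> real_of_int (\<alpha> r) < real n / 2) \<and>
     (0 < t \<longrightarrow> real_of_int (\<beta> t) < real n / 2) \<and>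
     (0 < s \<longrightarrow> \<gamma> s \<le> int n - 1)"

text \<open>Laurent polynomials are represented by the functions they define on the nonzero complex
  numbers.\<close>

definition lpA :: "nat \<Rightarrow> nat \<Rightarrow> (nat \<Rightarrow> int) \<Rightarrow> complex \<Rightarrow> complex" where
  "lpA r s \<alpha> z = of_nat (2 * r + s + 1) - (\<Sum>j=1..r. z powi (\<alpha> j) + z powi (- \<alpha> j))"

definition lpB :: "nat \<Rightarrow> nat \<Rightarrow> (nat \<Rightarrow> int) \<Rightarrow> complex \<Rightarrow> complex" where
  "lpB t s \<beta> z = of_nat (2 * t + s + 1) - (\<Sum>j=1..t. z powi (\<beta> j) + z powi (- \<beta> j))"

definition lpC :: "nat \<Rightarrow> (nat \<Rightarrow> int) \<Rightarrow> complex \<Rightarrow> complex" where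
  "lpC s \<gamma> z = - (\<Sum>j=1..s. z powi (\<gamma> j))"

definition P1 :: "nat \<Rightarrow> nat \<Rightarrow> nat \<Rightarrow> (nat \<Rightarrow> int) \<Rightarrow> (nat \<Rightarrow> int) \<Rightarrow> (nat \<Rightarrow> int) \<Rightarrow> complex \<Rightarrow> complex" where
  "P1 r t s \<alpha> \<beta> \<gamma> z = lpA r s \<alpha> z * lpB t s \<beta> z - lpC s \<gamma> (inverse z) * lpC s \<gamma> z"

definition P2 :: "nat \<Rightarrow> nat \<Rightarrow> nat \<Rightarrow> (nat \<Rightarrow> int) \<Rightarrow> (nat \<Rightarrow> int) \<Rightarrow> (nat \<Rightarrow> int) \<Rightarrow> complex \<Rightarrow> complex" where
  "P2 r t s \<alpha> \<beta> \<gamma> z = (lpA r s \<alpha> z + 2) * lpB t s \<beta> z - lpC s \<gamma> (inverse z) * lpC s \<gamma> z"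

definition P3 :: "nat \<Rightarrow> nat \<Rightarrow> nat \<Rightarrow> (nat \<Rightarrow> int) \<Rightarrow> (nat \<Rightarrow> int) \<Rightarrow> (nat \<Rightarrow> int) \<Rightarrow> complex \<Rightarrow> complex" where
  "P3 r t s \<alpha> \<beta> \<gamma> z = lpA r s \<alpha> z * (lpB t s \<beta> z + 2) - lpC s \<gamma> (inverse z) * lpC s \<gamma> z"

definition P4 :: "nat \<Rightarrow> nat \<Rightarrow> nat \<Rightarrow> (nat \<Rightarrow> int) \<Rightarrow> (nat \<Rightarrow> int) \<Rightarrow> (nat \<Rightarrow> int) \<Rightarrow> complex \<Rightarrow> complex" where
  "P4 r t s \<alpha> \<beta> \<gamma> z = (lpA r s \<alpha> z + 2) * (lpB t s \<beta> z + 2) - lpC s \<gamma> (inverse z) * lpC s \<gamma> z"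

definition mahler_measure :: "(complex \<Rightarrow> complex) \<Rightarrow> real" where
  "mahler_measure P = exp (integral {0..1} (\<lambda>x::real. ln (cmod (P (exp (2 * of_real pi * \<i> * of_real x))))))"

text \<open>\<open>f n \<sim> g n\<close> as \<open>n\<close> tends to infinity through the set \<open>N\<close>; void if \<open>N\<close> is finite.\<close>

definition asymp_along :: "nat set \<Rightarrow> (nat \<Rightarrow> real) \<Rightarrow> (nat \<Rightarrow> real) \<Rightarrow> bool" where
  "asymp_along N f g \<longleftrightarrow> ((\<lambda>n. f n / g n) \<longlongrightarrow> 1) (inf at_top (principal N))"

end

theory Submission
  imports Defs "Jordan_Normal_Form.Determinant"
begin

text \<open>
  A rooted forest is the same as a map sending each vertex to its parent and each root to itself.
  Row \<open>v\<close> of \<open>I + L\<close>, with \<open>L\<close> the graph Laplacian, is the sum of the rows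
  \<open>e\<^sub>v\<close> (choose \<open>v\<close> as a root) and \<open>e\<^sub>v - e\<^sub>w\<close> (choose the neighbour \<open>w\<close> as parent), so multilinearity
  expands \<open>det (I + L)\<close> into a sum over such maps; a choice contributes 1 if following parents always
  leads to a root and 0 if there is a cycle. For a bicirculant graph the discrete Fourier transform
  turns \<open>det (I + L)\<close> into a product of values of the polynomials $P_i$ at roots of unity: all at
  \<open>n\<close>-th roots of unity for $\Gamma_1$; in the other cases, since \<open>\<omega>^(n/2) = \<plusminus> 1\<close>, those of $P_1$ at the
  solutions of \<open>z^(n/2) = 1\<close> and those of $P_2, P_3, P_4$ at the solutions of \<open>z^(n/2) = - 1\<close>.
  On the unit circle the $P_i$ are real and at least \<open>(s + 1)\<^sup>2 - s\<^sup>2 > 0\<close>, so their logarithms are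
  smooth and periodic, and the trapezoid and midpoint sums with \<open>m\<close> nodes differ from \<open>m\<close> times the
  integral by \<open>O(1/m)\<close>.
\<close>

section \<open>Rooted forests as parent maps\<close>

text \<open>A ratio tending to 1 asks for more than a growth rate: the logarithm of the product must
  match \<open>m\<close> times the integral up to \<open>o(1)\<close>. Convergence of Riemann sums
  alone gives only \<open>o(m)\<close>, and the left-endpoint rule for a smooth function can leave a
  nonzero constant. Hence the second-order quadrature, and hence the importance of where the nodes
  fall. In units of a full turn, the solutions of \<open>z^m = 1\<close> have arguments
  \<open>k/m\<close>, where periodicity turns the left-endpoint sum into a trapezoid sum; those of
  \<open>z^m = -1\<close> have arguments \<open>(k + 1/2)/m\<close>, the midpoints of the cells.

  The summand 1 in the constant terms of the polynomials A and B is the matrix \<open>I\<close> in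
  \<open>I + L\<close>. Without it the analogue of $P_1$ would vanish at \<open>z = 1\<close>, and
  its logarithm would be singular there.

  Each forest number is computed exactly for fixed \<open>n\<close>; limits enter only through the
  quadrature. The determinants are taken over the complex numbers because the Fourier matrix lives
  there, and the resulting product identity is pulled back to the reals.\<close>

text \<open>Roots are encoded as the fixed points of a parent map.\<close>

definition rooted_maps :: "'a set \<Rightarrow> ('a \<Rightarrow> 'a set) \<Rightarrow> ('a \<Rightarrow> 'a) set" where
  "rooted_maps V B = {g \<in> PiE V B. \<forall>v\<in>V. \<exists>k. g ((g ^^ k) v) = (g ^^ k) v}"

text \<open>The distance to the root along parents. If no fixed point is ever reached,
  \<open>LEAST\<close> is unspecified, so the facts about depth assume existence of some
  \<open>k\<close>.\<close>

definition map_depth :: "('a \<Rightarrow> 'a) \<Rightarrow> 'a \<Rightarrow> nat" where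
  "map_depth g v = (LEAST k. g ((g ^^ k) v) = (g ^^ k) v)"

definition map_forest :: "'a set \<Rightarrow> ('a \<Rightarrow> 'a) \<Rightarrow> 'a ugraph \<times> 'a set" where
  "map_forest V g = (\<lparr>gverts = V, gedges = {{v, g v} |v. v \<in> V \<and> g v \<noteq> v}\<rparr>, {v \<in> V. g v = v})"

text \<open>Since 0 is not yet a solution, the least solution for \<open>v\<close> is one more than
  the least solution for its parent. This strict descent orients edges, excludes cycles and kills
  Leibniz terms.\<close>

lemma map_depth_step:
  assumes "\<exists>k. g ((g ^^ k) v) = (g ^^ k) v" "g v \<noteq> v"
  shows "map_depth g v = Suc (map_depth g (g v))"
proof -
  obtain k where "g ((g ^^ k) v) = (g ^^ k) v" using assms by blast
  then have "(LEAST k. g ((g ^^ k) v) = (g ^^ k) v)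
      = Suc (LEAST k. g ((g ^^ Suc k) v) = (g ^^ Suc k) v)"
    by (rule Least_Suc) (use assms in simp)
  then show ?thesis by (simp add: map_depth_def funpow_swap1)
qed

section \<open>Forests produced by parent maps\<close>

lemma funpow_in:
  assumes "v \<in> V" "\<And>u. u \<in> V \<Longrightarrow> g u \<in> V"
  shows "(g ^^ k) v \<in> V"
  by (induction k) (use assms in auto)

lemma gadj_sym: "(u, v) \<in> gadj H \<longleftrightarrow> (v, u) \<in> gadj H"
  by (simp add: gadj_def insert_commute)

lemma gadj_rtrancl_sym: "(u, v) \<in> (gadj H)\<^sup>* \<Longrightarrow> (v, u) \<in> (gadj H)\<^sup>*"
proof (induction rule: rtrancl_induct)
  case (step y z)
  then show ?case by (metis gadj_sym converse_rtrancl_into_rtrancl)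
qed auto

lemma map_forest_adj:
  "(u, v) \<in> gadj (fst (map_forest V g)) \<longleftrightarrow>
     (u \<in> V \<and> v = g u \<and> u \<noteq> v) \<or> (v \<in> V \<and> u = g v \<and> u \<noteq> v)"
  by (auto simp: map_forest_def gadj_def doubleton_eq_iff)

text \<open>A deepest vertex of a cycle would have its parent as both neighbours on the cycle.\<close>

lemma acyclic_map_forest:
  assumes g: "g \<in> rooted_maps V B"
  shows "acyclic_graph (fst (map_forest V g))"
  unfolding acyclic_graph_def
proof
  let ?H = "fst (map_forest V g)"
  assume "\<exists>vs. graph_cycle ?H vs"
  then obtain vs where vs: "3 \<le> length vs" "distinct vs"
     "\<And>i. i < length vs \<Longrightarrow> {vs ! i, vs ! (Suc i mod length vs)} \<in> gedges ?H"
     "set vs \<subseteq> V"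
    unfolding graph_cycle_def map_forest_def by auto
  let ?l = "length vs"
  have fx: "\<exists>k. g ((g ^^ k) v) = (g ^^ k) v" if "v \<in> V" for v
    using g that by (auto simp: rooted_maps_def)
  define m where "m = Max ((\<lambda>i. map_depth g (vs ! i)) ` {..<?l})"
  have "m \<in> (\<lambda>i. map_depth g (vs ! i)) ` {..<?l}"
    unfolding m_def using vs(1) by (intro Max_in) (auto simp: lessThan_empty_iff)
  then obtain i where i: "i < ?l" "map_depth g (vs ! i) = m" by auto
  have le: "map_depth g (vs ! j) \<le> map_depth g (vs ! i)" if "j < ?l" for j
    unfolding i(2) m_def using that by (intro Max_ge) auto
  \<comment> \<open>The other way to be adjacent, \<open>vs ! i\<close> as the parent of
    \<open>vs ! j\<close>, would make \<open>vs ! j\<close> deeper than the maximum.\<close>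
  have nb: "vs ! j = g (vs ! i)" if j: "j < ?l" and "(vs ! i, vs ! j) \<in> gadj ?H" for j
  proof -
    have "vs ! j \<in> V" using j vs(4) by auto
    with le[OF j] that(2) map_depth_step[OF fx, of "vs ! j"] show ?thesis
      unfolding map_forest_adj by auto
  qed
  define p where "p = (if i = 0 then ?l - 1 else i - 1)"
  have p: "p < ?l" "Suc p mod ?l = i" using i vs(1) by (auto simp: p_def)
  define q where "q = Suc i mod ?l"
  have q: "q < ?l" using vs(1) unfolding q_def by (intro mod_less_divisor) auto
  \<comment> \<open>Predecessor and successor on the cycle are different positions because a cycle
    has at least three vertices.\<close>
  have pq: "p \<noteq> q"
  proof (cases "Suc i = ?l")
    case True then show ?thesis using vs(1) i unfolding p_def q_def by auto
  next
    case False then show ?thesis using vs(1) i unfolding p_def q_def by auto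
  qed
  have "(vs ! i, vs ! q) \<in> gadj ?H" using vs(3)[OF i(1)] by (simp add: gadj_def q_def)
  moreover have "(vs ! i, vs ! p) \<in> gadj ?H"
    using vs(3)[OF p(1)] p(2) by (simp add: gadj_def insert_commute)
  ultimately have "vs ! p = vs ! q" using nb[OF p(1)] nb[OF q] by simp
  then show False using vs(2) p q pq by (simp add: nth_eq_iff_index_eq)
qed

lemma map_forest_reaches_root:
  assumes "v \<in> V" "\<And>u. u \<in> V \<Longrightarrow> g u \<in> V"
  shows "(v, (g ^^ k) v) \<in> (gadj (fst (map_forest V g)))\<^sup>*"
proof (induction k)
  case (Suc k)
  have "(g ^^ k) v \<in> V" using funpow_in assms by metis
  then have "g ((g ^^ k) v) = (g ^^ k) v \<or>
      ((g ^^ k) v, g ((g ^^ k) v)) \<in> gadj (fst (map_forest V g))"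
    unfolding map_forest_adj by auto
  then show ?case using Suc by (auto intro: rtrancl_into_rtrancl)
qed auto

lemma rooted_map_closed:
  assumes "g \<in> rooted_maps V B" "\<And>v. v \<in> V \<Longrightarrow> B v \<subseteq> V" "v \<in> V"
  shows "g v \<in> V"
proof -
  have "g v \<in> B v" using assms(1,3) by (auto simp: rooted_maps_def PiE_def Pi_def)
  then show ?thesis using assms(2)[OF assms(3)] by auto
qed

lemma rooted_map_fix:
  assumes "g \<in> rooted_maps V B" "v \<in> V"
  shows "\<exists>k. g ((g ^^ k) v) = (g ^^ k) v"
  using assms by (auto simp: rooted_maps_def)

definition map_root :: "('a \<Rightarrow> 'a) \<Rightarrow> 'a \<Rightarrow> 'a" where
  "map_root g v = (g ^^ map_depth g v) v"

lemma map_root_fixed: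
  assumes "\<exists>k. g ((g ^^ k) v) = (g ^^ k) v"
  shows "g (map_root g v) = map_root g v"
  unfolding map_root_def map_depth_def using assms by (rule LeastI_ex)

lemma map_root_step:
  assumes "\<exists>k. g ((g ^^ k) v) = (g ^^ k) v"
  shows "map_root g (g v) = map_root g v"
  using map_depth_step[OF assms] by (cases "g v = v") (auto simp: map_root_def funpow_swap1)

lemma map_root_self: "g v = v \<Longrightarrow> map_root g v = v"
proof -
  assume "g v = v"
  then have "(g ^^ k) v = v" for k by (induction k) auto
  then show ?thesis by (simp add: map_root_def)
qed

text \<open>Every edge joins a vertex to its parent, and these share their root. A fixed point is
  its own root, so a component cannot contain two of them.\<close>

lemma map_forest_component_root:
  assumes g: "g \<in> rooted_maps V B"
    and uv: "(u, v) \<in> (gadj (fst (map_forest V g)))\<^sup>*"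
  shows "map_root g u = map_root g v"
  using uv
proof (induction rule: rtrancl_induct)
  case (step y z)
  from step(2) consider "y \<in> V" "z = g y" | "z \<in> V" "y = g z"
    unfolding map_forest_adj by auto
  then have "map_root g y = map_root g z"
    by cases (use map_root_step[OF rooted_map_fix[OF g]] in simp_all)
  then show ?case using step by simp
qed auto

lemma map_forest_in:
  assumes g: "g \<in> rooted_maps (gverts G) (\<lambda>v. insert v {w \<in> gverts G. {v, w} \<in> gedges G})"
  shows "map_forest (gverts G) g \<in> rooted_spanning_forests G"
proof -
  let ?V = "gverts G" let ?H = "fst (map_forest ?V g)"
  have BV: "g v \<in> ?V" if "v \<in> ?V" for v by (rule rooted_map_closed[OF g _ that]) auto
  have ac: "acyclic_graph ?H" by (rule acyclic_map_forest[OF g])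
  have "g v = v \<or> {v, g v} \<in> gedges G" if "v \<in> ?V" for v
    using g that by (auto simp: rooted_maps_def PiE_def Pi_def)
  then have 1: "gedges ?H \<subseteq> gedges G" by (auto simp: map_forest_def)
  have 2: "\<exists>!q. q \<in> K \<and> q \<in> {v \<in> ?V. g v = v}" if "K \<in> graph_components ?H" for K
  proof -
    have "gverts ?H = ?V" by (simp add: map_forest_def)
    with that obtain v where v: "v \<in> ?V" "K = {u \<in> ?V. (v, u) \<in> (gadj ?H)\<^sup>*}"
      unfolding graph_components_def by auto
    have "map_root g v \<in> ?V"
      unfolding map_root_def by (rule funpow_in[OF v(1) BV])
    moreover have "(v, map_root g v) \<in> (gadj ?H)\<^sup>*"
      unfolding map_root_def by (rule map_forest_reaches_root[OF v(1) BV])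
    ultimately have "map_root g v \<in> K \<and> map_root g v \<in> {v \<in> ?V. g v = v}"
      using map_root_fixed[OF rooted_map_fix[OF g v(1)]] v by auto
    moreover have "q = map_root g v" if "q \<in> K" "g q = q" for q
    proof -
      have "(v, q) \<in> (gadj ?H)\<^sup>*" using that v by auto
      then have "map_root g v = map_root g q" by (intro map_forest_component_root[OF g])
      then show ?thesis using map_root_self[of g q] that by simp
    qed
    ultimately show ?thesis by blast
  qed
  show ?thesis
    using ac 1 2 unfolding rooted_spanning_forests_def map_forest_def by auto
qed

text \<open>The forest is undirected, so the orientation has to be recovered from the roots
  outwards, by induction on depth. The edge from \<open>v\<close> to \<open>g v\<close> is used by
  \<open>h\<close> in one of two directions; the wrong one means \<open>h (g v) = v\<close>, whereas
  the induction hypothesis gives \<open>h (g v) = g (g v)\<close>, and \<open>g (g v) = v\<close>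
  contradicts the descent of depth.\<close>

lemma map_forest_inj:
  assumes g: "g \<in> rooted_maps V B" and h: "h \<in> rooted_maps V B" and BV: "\<And>v. v \<in> V \<Longrightarrow> B v \<subseteq> V"
    and eq: "map_forest V g = map_forest V h"
  shows "g = h"
proof -
  have fixeq: "g v = v \<longleftrightarrow> h v = v" if "v \<in> V" for v
    using eq that unfolding map_forest_def by auto
  have "h v = g v" if "v \<in> V" for v
    using that
  proof (induction "map_depth g v" arbitrary: v rule: less_induct)
    case less
    show ?case
    proof (cases "g v = v")
      case True then show ?thesis using fixeq[OF less(2)] by simp
    next
      case False
      let ?w = "g v"
      have w: "?w \<in> V" using rooted_map_closed[OF g BV] less(2) by auto
      have d: "map_depth g v = Suc (map_depth g ?w)"
        using map_depth_step[OF rooted_map_fix[OF g]] less(2) False by auto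
      then have IH: "h ?w = g ?w" by (intro less(1)[OF _ w]) simp
      have "(v, ?w) \<in> gadj (fst (map_forest V g))"
        using less(2) False unfolding map_forest_adj by auto
      then have "?w = h v \<or> v = h ?w" unfolding eq map_forest_adj by auto
      moreover have "v \<noteq> g ?w"
      proof
        assume a: "v = g ?w"
        then have "g ?w \<noteq> ?w" using False by auto
        then have "map_depth g ?w = Suc (map_depth g v)"
          using map_depth_step[OF rooted_map_fix[OF g w]] a by auto
        with d show False by auto
      qed
      ultimately show ?thesis using IH by metis
    qed
  qed
  moreover have "g \<in> PiE V B" "h \<in> PiE V B" using g h by (auto simp: rooted_maps_def)
  ultimately show ?thesis by (intro PiE_ext[of g V B h]) auto
qed

section \<open>Every rooted spanning forest comes from a parent map\<close>

text \<open>A walk about to revisit a vertex is cut back to that vertex instead of being extended.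
  Distinctness is what allows the walk to be closed to a cycle later.\<close>

lemma distinct_walk_exists:
  assumes "(u, w) \<in> r\<^sup>*"
  shows "\<exists>vs. vs \<noteq> [] \<and> hd vs = u \<and> last vs = w \<and> distinct vs \<and> successively (\<lambda>x y. (x, y) \<in> r) vs"
  using assms
proof (induction rule: rtrancl_induct)
  case base
  show ?case by (rule exI[of _ "[u]"]) auto
next
  case (step y z)
  then obtain vs where vs: "vs \<noteq> []" "hd vs = u" "last vs = y" "distinct vs"
    "successively (\<lambda>x y. (x, y) \<in> r) vs" by auto
  show ?case
  proof (cases "z \<in> set vs")
    case True
    then obtain xs ys where xs: "vs = xs @ z # ys" by (meson split_list)
    then have "vs = (xs @ [z]) @ ys" by simp
    then have "successively (\<lambda>x y. (x, y) \<in> r) (xs @ [z])"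
      using vs(5) successively_append_iff by metis
    then show ?thesis
      using vs xs by (intro exI[of _ "xs @ [z]"]) (cases xs; auto)
  next
    case False
    then show ?thesis
      using vs step(2) by (intro exI[of _ "vs @ [z]"]) (auto simp: successively_append_iff)
  qed
qed

text \<open>A walk from \<open>u\<close> to \<open>w\<close> that avoids the edge between them
  would, together with this edge, be a cycle.\<close>

lemma acyclic_graph_edge_bridge:
  assumes ac: "acyclic_graph H" and uw: "{u, w} \<in> gedges H" "u \<noteq> w"
    and V: "\<Union>(gedges H) \<subseteq> gverts H"
    and E: "E \<subseteq> gedges H" and path: "(u, w) \<in> {(x, y). {x, y} \<in> E}\<^sup>*"
  shows "{u, w} \<in> E"
proof (rule ccontr)
  assume nE: "{u, w} \<notin> E"
  obtain vs where vs: "vs \<noteq> []" "hd vs = u" "last vs = w" "distinct vs"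
    "successively (\<lambda>x y. {x, y} \<in> E) vs"
    using distinct_walk_exists[OF path] by auto
  have suc: "{vs ! i, vs ! Suc i} \<in> E" if "Suc i < length vs" for i
    using vs(5) that by (auto simp: successively_conv_nth)
  have u: "vs ! 0 = u" and w: "vs ! (length vs - 1) = w"
    using vs by (auto simp: hd_conv_nth last_conv_nth)
  \<comment> \<open>One vertex would mean \<open>u = w\<close>; two would mean that the walk is the
    edge itself, hence in \<open>E\<close>.\<close>
  have "length vs \<noteq> 0" "length vs \<noteq> 1" using vs uw(2) u w by auto
  moreover have "length vs \<noteq> 2" using suc[of 0] u w nE by auto
  ultimately have len: "3 \<le> length vs" by linarith
  have edge: "{vs ! i, vs ! (Suc i mod length vs)} \<in> gedges H" if "i < length vs" for i
  proof (cases "Suc i = length vs")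
    case True
    then have "i = length vs - 1" by auto
    then show ?thesis using True u w uw by (simp add: insert_commute)
  next
    case False
    then show ?thesis using suc[of i] that E by auto
  qed
  have "vs ! i \<in> gverts H" if "i < length vs" for i using edge[OF that] V by auto
  then have "set vs \<subseteq> gverts H" by (auto simp: in_set_conv_nth)
  then have "graph_cycle H vs" using len edge vs(4) unfolding graph_cycle_def by auto
  then show False using ac unfolding acyclic_graph_def by blast
qed

text \<open>The record type by itself admits loops, edges of other sizes and edges leaving the
  vertex set.\<close>

definition simple_edges :: "'a ugraph \<Rightarrow> bool" where
  "simple_edges G \<longleftrightarrow> (\<forall>e\<in>gedges G. \<exists>u v. u \<noteq> v \<and> u \<in> gverts G \<and> v \<in> gverts G \<and> e = {u, v})"

lemma simple_edgesD:
  assumes "simple_edges G" "{u, v} \<in> gedges G"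
  shows "u \<noteq> v" "u \<in> gverts G" "v \<in> gverts G"
proof -
  obtain x y where "x \<noteq> y" "x \<in> gverts G" "y \<in> gverts G" "{u, v} = {x, y}"
    using assms unfolding simple_edges_def by blast
  then show "u \<noteq> v" "u \<in> gverts G" "v \<in> gverts G" by (auto simp: doubleton_eq_iff)
qed

text \<open>A shortest path from \<open>v\<close> to \<open>Q\<close> has positive length because
  \<open>v\<close> lies outside \<open>Q\<close>; its first step leaves a shorter path.\<close>

lemma relpow_closer_neighbour:
  fixes r :: "('a \<times> 'a) set"
  defines "d \<equiv> \<lambda>v Q. LEAST k. \<exists>q\<in>Q. (v, q) \<in> r ^^ k"
  assumes "(v, q) \<in> r\<^sup>*" "q \<in> Q" "v \<notin> Q"
  shows "\<exists>w. (v, w) \<in> r \<and> d w Q < d v Q"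
proof -
  obtain k where k: "(v, q) \<in> r ^^ k" using assms(2) rtrancl_imp_relpow by metis
  then have ex: "\<exists>k. \<exists>q\<in>Q. (v, q) \<in> r ^^ k" using assms(3) by auto
  have "\<exists>q\<in>Q. (v, q) \<in> r ^^ (d v Q)"
    unfolding d_def by (rule LeastI_ex) (rule ex)
  then obtain q' where q': "q' \<in> Q" "(v, q') \<in> r ^^ (d v Q)" by auto
  then obtain j where j: "d v Q = Suc j" using assms(4) by (cases "d v Q") auto
  then obtain w where w: "(v, w) \<in> r" "(w, q') \<in> r ^^ j"
    using q' relpow_Suc_D2 by metis
  have "d w Q \<le> j" unfolding d_def by (rule Least_le) (use w q' in auto)
  then show ?thesis using w j by auto
qed

text \<open>Parents are chosen closer to the root set. Any further edge of the forest would close a cycle,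
  since both its ends are already joined to the root of their component.\<close>

lemma map_forest_surj:
  assumes G: "simple_edges G" and HQ: "(H, Q) \<in> rooted_spanning_forests G"
  shows "\<exists>g\<in>rooted_maps (gverts G) (\<lambda>v. insert v {w \<in> gverts G. {v, w} \<in> gedges G}).
           map_forest (gverts G) g = (H, Q)"
proof -
  let ?V = "gverts G"
  define r where "r = gadj H"
  define d where "d v = (LEAST k. \<exists>q\<in>Q. (v, q) \<in> r ^^ k)" for v
  have H: "gverts H = ?V" "gedges H \<subseteq> gedges G" "acyclic_graph H" "Q \<subseteq> ?V"
    and comp: "\<And>K. K \<in> graph_components H \<Longrightarrow> \<exists>!q. q \<in> K \<and> q \<in> Q"
    using HQ by (auto simp: rooted_spanning_forests_def)
  have GH: "simple_edges H" using G H unfolding simple_edges_def by auto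
  have HV: "\<Union>(gedges H) \<subseteq> gverts H" using GH unfolding simple_edges_def by auto
  have root: "\<exists>!q. (v, q) \<in> r\<^sup>* \<and> q \<in> Q" if "v \<in> ?V" for v
  proof -
    have "{u \<in> ?V. (v, u) \<in> r\<^sup>*} \<in> graph_components H"
      using that H unfolding graph_components_def r_def by auto
    from comp[OF this] show ?thesis using H(4) by (auto intro: ex_ex1I)
  qed
  have step: "\<exists>w. (v, w) \<in> r \<and> d w < d v" if v: "v \<in> ?V" "v \<notin> Q" for v
  proof -
    obtain q where "(v, q) \<in> r\<^sup>*" "q \<in> Q" using root[OF v(1)] by auto
    then show ?thesis using relpow_closer_neighbour[of v q r Q] v(2) unfolding d_def by simp
  qed
  define g where "g = (\<lambda>v\<in>?V. if v \<in> Q then v else SOME w. (v, w) \<in> r \<and> d w < d v)"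
  have gQ: "g v = v" if "v \<in> Q" for v using that H by (auto simp: g_def)
  have gn: "(v, g v) \<in> r" "d (g v) < d v" if "v \<in> ?V" "v \<notin> Q" for v
    using someI_ex[OF step[OF that]] that by (auto simp: g_def)
  have gadj: "{v, g v} \<in> gedges H" "g v \<in> ?V" "g v \<noteq> v" if "v \<in> ?V" "v \<notin> Q" for v
  proof -
    show "{v, g v} \<in> gedges H" using gn(1)[OF that] by (simp add: r_def gadj_def)
    then show "g v \<in> ?V" "g v \<noteq> v" using simple_edgesD[OF GH] H(1) by metis+
  qed
  have fixQ: "g v = v \<longleftrightarrow> v \<in> Q" if "v \<in> ?V" for v
    using that gQ gadj(3) by blast
  have closed: "g v \<in> ?V" if "v \<in> ?V" for v using gQ gadj(2) that by metis
  have ex: "\<exists>k. g ((g ^^ k) v) = (g ^^ k) v" if "v \<in> ?V" for v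
    using that
  proof (induction "d v" arbitrary: v rule: less_induct)
    case less
    show ?case
    proof (cases "v \<in> Q")
      case True
      then show ?thesis using gQ by (intro exI[of _ 0]) auto
    next
      case False
      then obtain k where "g ((g ^^ k) (g v)) = (g ^^ k) (g v)"
        using less gn closed by blast
      then show ?thesis by (intro exI[of _ "Suc k"]) (simp add: funpow_swap1)
    qed
  qed
  have gP: "g \<in> PiE ?V (\<lambda>v. insert v {w \<in> ?V. {v, w} \<in> gedges G})"
  proof (rule PiE_I)
    fix v assume "v \<in> ?V"
    then show "g v \<in> insert v {w \<in> ?V. {v, w} \<in> gedges G}"
      using gQ[of v] gadj(1,2)[of v] H(2) by (cases "v \<in> Q") auto
  qed (auto simp: g_def)
  have grm: "g \<in> rooted_maps ?V (\<lambda>v. insert v {w \<in> ?V. {v, w} \<in> gedges G})"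
    using gP ex by (auto simp: rooted_maps_def)
  let ?F = "fst (map_forest ?V g)"
  have FE: "gedges ?F = {{v, g v} |v. v \<in> ?V \<and> g v \<noteq> v}" by (simp add: map_forest_def)
  have F: "gedges ?F \<subseteq> gedges H" using gadj(1) fixQ unfolding FE by auto
  have reach: "(v, map_root g v) \<in> (gadj ?F)\<^sup>*" "map_root g v \<in> Q" if "v \<in> ?V" for v
  proof -
    show "(v, map_root g v) \<in> (gadj ?F)\<^sup>*"
      unfolding map_root_def by (rule map_forest_reaches_root[OF that closed])
    have "map_root g v \<in> ?V" unfolding map_root_def by (rule funpow_in[OF that closed])
    then show "map_root g v \<in> Q" using map_root_fixed[OF ex[OF that]] fixQ by auto
  qed
  have sub: "gadj ?F \<subseteq> r" using F by (auto simp: gadj_def r_def)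
  have "gedges H \<subseteq> gedges ?F"
  proof
    fix e assume e: "e \<in> gedges H"
    then obtain u w where uw: "e = {u, w}" "u \<noteq> w" "u \<in> ?V" "w \<in> ?V"
      using GH H(1) unfolding simple_edges_def by auto
    have "(u, w) \<in> r" using e uw by (simp add: r_def gadj_def)
    then have "(u, map_root g w) \<in> r\<^sup>*"
      by (rule converse_rtrancl_into_rtrancl) (use reach(1)[OF uw(4)] rtrancl_mono[OF sub] in auto)
    moreover have "(u, map_root g u) \<in> r\<^sup>*"
      using reach(1)[OF uw(3)] rtrancl_mono[OF sub] by auto
    \<comment> \<open>Both roots lie in \<open>Q\<close> and are reachable from \<open>u\<close> in
      the given forest, whose components have a single root each.\<close>
    ultimately have "map_root g u = map_root g w"
      using root[OF uw(3)] reach(2)[OF uw(3)] reach(2)[OF uw(4)] by blast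
    then have "(u, w) \<in> (gadj ?F)\<^sup>*"
      using reach(1)[OF uw(3)] gadj_rtrancl_sym[OF reach(1)[OF uw(4)]] by (metis rtrancl_trans)
    then have "{u, w} \<in> gedges ?F"
      using acyclic_graph_edge_bridge[OF H(3) _ uw(2) HV F] e uw(1) unfolding gadj_def by simp
    then show "e \<in> gedges ?F" using uw by simp
  qed
  with F have "gedges ?F = gedges H" by auto
  moreover have "{v \<in> ?V. g v = v} = Q" using fixQ H(4) by auto
  ultimately have "map_forest ?V g = (H, Q)"
    using H(1) by (simp add: map_forest_def)
  then show ?thesis using grm by blast
qed

text \<open>The choice set of \<open>v\<close> contains \<open>v\<close> for the case of a root, so
  its size is the degree plus one, the diagonal entry of \<open>I + L\<close>.\<close>

theorem num_rooted_spanning_forests_eq: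
  assumes "simple_edges G"
  shows "num_rooted_spanning_forests G =
    card (rooted_maps (gverts G) (\<lambda>v. insert v {w \<in> gverts G. {v, w} \<in> gedges G}))"
proof -
  let ?M = "rooted_maps (gverts G) (\<lambda>v. insert v {w \<in> gverts G. {v, w} \<in> gedges G})"
  have "bij_betw (map_forest (gverts G)) ?M (rooted_spanning_forests G)"
    unfolding bij_betw_def
  proof
    show "inj_on (map_forest (gverts G)) ?M"
    proof (rule inj_onI)
      fix g h assume gh: "g \<in> ?M" "h \<in> ?M" "map_forest (gverts G) g = map_forest (gverts G) h"
      show "g = h" by (rule map_forest_inj[OF gh(1,2) _ gh(3)]) auto
    qed
    show "map_forest (gverts G) ` ?M = rooted_spanning_forests G"
    proof (rule subset_antisym; rule subsetI)
      fix x assume "x \<in> map_forest (gverts G) ` ?M"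
      then obtain g where g: "g \<in> ?M" "x = map_forest (gverts G) g" by (rule imageE)
      show "x \<in> rooted_spanning_forests G" unfolding g(2) by (rule map_forest_in[OF g(1)])
    next
      fix x assume "x \<in> rooted_spanning_forests G"
      then have "\<exists>g\<in>?M. map_forest (gverts G) g = x"
        using map_forest_surj[OF assms, of "fst x" "snd x"] by simp
      then show "x \<in> map_forest (gverts G) ` ?M" by (blast intro: sym)
    qed
  qed
  then show ?thesis unfolding num_rooted_spanning_forests_def by (simp add: bij_betw_same_card)
qed

section \<open>The matrix forest theorem\<close>

definition pointer_row :: "'a \<Rightarrow> 'a \<Rightarrow> 'a \<Rightarrow> complex" where
  "pointer_row v w u = (if u = v then 1 else 0) - (if w \<noteq> v \<and> u = w then 1 else 0)"

text \<open>For \<open>S\<close> the closed neighbourhood of \<open>v\<close> the right side is row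
  \<open>v\<close> of \<open>I + L\<close>, so this is the splitting of a row to which
  multilinearity is applied.\<close>

lemma sum_pointer_row:
  assumes "finite S" "v \<in> S"
  shows "(\<Sum>w\<in>S. pointer_row v w u) =
    (if u = v then of_nat (card S) else if u \<in> S then -1 else 0)"
proof -
  have "(\<Sum>w\<in>S. if w \<noteq> v \<and> u = w then 1 else 0 :: complex) = (if u \<noteq> v \<and> u \<in> S then 1 else 0)"
    using assms(1) by (subst sum.mono_neutral_cong_right[of S "{u} \<inter> S - {v}"]) auto
  then show ?thesis by (simp add: pointer_row_def sum_subtractf)
qed

text \<open>A permutation with nonzero Leibniz term moves vertices only to their parents, so a moved
  vertex of least depth cannot exist.\<close>

lemma det_pointer_matrix_rooted:
  assumes e: "bij_betw e {0..<N} V" and g: "\<forall>v\<in>V. \<exists>k. g ((g ^^ k) v) = (g ^^ k) v"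
  shows "Determinant.det (Matrix.mat N N (\<lambda>(i, j). pointer_row (e i) (g (e i)) (e j))) = 1"
proof -
  have eV: "e i \<in> V" if "i < N" for i using e that by (auto simp: bij_betw_def)
  have inj: "e i = e j \<longleftrightarrow> i = j" if "i < N" "j < N" for i j
    using e that by (auto simp: bij_betw_def inj_on_def)
  let ?f = "\<lambda>p. signof p * (\<Prod>i = 0..<N. pointer_row (e i) (g (e i)) (e (p i)))"
  have zero: "?f p = 0" if p: "p permutes {0..<N}" "p \<noteq> id" for p
  proof (rule ccontr)
    assume "?f p \<noteq> 0"
    then have nz: "pointer_row (e i) (g (e i)) (e (p i)) \<noteq> 0" if "i < N" for i
      using that by auto
    define D where "D = {i. i < N \<and> p i \<noteq> i}"
    have pN: "p i < N" if "i < N" for i using permutes_in_image[OF p(1)] that by auto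
    obtain i0 where "p i0 \<noteq> i0" using p(2) by (auto simp: fun_eq_iff)
    then have "i0 \<in> D" using permutes_not_in[OF p(1), of i0] by (auto simp: D_def)
    then obtain i where i: "i \<in> D" "\<And>j. j \<in> D \<Longrightarrow> map_depth g (e i) \<le> map_depth g (e j)"
      using ex_has_least_nat[of "\<lambda>i. i \<in> D" i0 "\<lambda>i. map_depth g (e i)"] by blast
    then have iN: "i < N" "p i \<noteq> i" by (auto simp: D_def)
    then have "e (p i) \<noteq> e i" using inj pN by auto
    with nz[OF iN(1)] have w: "e (p i) = g (e i)" "g (e i) \<noteq> e i"
      by (auto simp: pointer_row_def split: if_splits)
    \<comment> \<open>By injectivity a permutation moves the image of every moved point. So
      \<open>p i\<close> is again in \<open>D\<close>, one level closer to the root than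
      \<open>i\<close>.\<close>
    have "p (p i) \<noteq> p i" using iN(2) permutes_inj[OF p(1)] by (auto dest: injD)
    then have "p i \<in> D" using pN iN by (auto simp: D_def)
    then have "map_depth g (e i) \<le> map_depth g (g (e i))" using i(2) w by metis
    then show False using map_depth_step[of g "e i"] g eV[OF iN(1)] w(2) by auto
  qed
  have "Determinant.det (Matrix.mat N N (\<lambda>(i, j). pointer_row (e i) (g (e i)) (e j)))
      = (\<Sum>p | p permutes {0..<N}. ?f p)"
    by (subst det_def'[of _ N]) (auto intro!: sum.cong prod.cong simp: permutes_in_image)
  also have "\<dots> = (\<Sum>p\<in>{id}. ?f p)"
    using zero by (intro sum.mono_neutral_right) (auto simp: permutes_id finite_permutations)
  also have "\<dots> = 1" by (auto simp: pointer_row_def intro!: prod.neutral)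
  finally show ?thesis .
qed

text \<open>The indicator of the vertices that never reach a fixed point lies in the kernel.\<close>

lemma det_pointer_matrix_not_rooted:
  assumes e: "bij_betw e {0..<N} V" and gV: "\<forall>v\<in>V. g v \<in> V"
    and g: "\<not> (\<forall>v\<in>V. \<exists>k. g ((g ^^ k) v) = (g ^^ k) v)"
  shows "Determinant.det (Matrix.mat N N (\<lambda>(i, j). pointer_row (e i) (g (e i)) (e j))) = 0"
proof -
  let ?M = "Matrix.mat N N (\<lambda>(i, j). pointer_row (e i) (g (e i)) (e j))"
  define y :: "'a \<Rightarrow> complex" where
    "y v = (if \<exists>k. g ((g ^^ k) v) = (g ^^ k) v then 0 else 1)" for v
  let ?x = "Matrix.vec N (\<lambda>i. y (e i))"
  have fV: "finite V" using bij_betw_finite[OF e] by simp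
  have eV: "e i \<in> V" if "i < N" for i using e that by (auto simp: bij_betw_def)
  have y0: "y v = 0" if "g v = v" for v
    using that unfolding y_def by (auto intro: exI[of _ 0])
  have yg: "y (g v) = y v" for v
  proof -
    have "(\<exists>k. g ((g ^^ k) (g v)) = (g ^^ k) (g v)) \<longleftrightarrow> (\<exists>k. g ((g ^^ k) v) = (g ^^ k) v)"
    proof
      assume "\<exists>k. g ((g ^^ k) (g v)) = (g ^^ k) (g v)"
      then obtain k where "g ((g ^^ k) (g v)) = (g ^^ k) (g v)" by blast
      then have "g ((g ^^ Suc k) v) = (g ^^ Suc k) v" by (simp add: funpow_swap1)
      then show "\<exists>k. g ((g ^^ k) v) = (g ^^ k) v" by blast
    next
      assume "\<exists>k. g ((g ^^ k) v) = (g ^^ k) v"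
      then obtain k where "g ((g ^^ k) v) = (g ^^ k) v" by blast
      then have "g ((g ^^ k) (g v)) = (g ^^ k) (g v)" by (simp add: funpow_swap1[symmetric])
      then show "\<exists>k. g ((g ^^ k) (g v)) = (g ^^ k) (g v)" by blast
    qed
    then show ?thesis by (simp add: y_def)
  qed
  \<comment> \<open>The row maps \<open>y\<close> to \<open>y v - y (g v)\<close>, which vanishes as
    \<open>y\<close> is constant along parents, or to \<open>y v\<close> at a fixed point, where
    \<open>y\<close> is 0.\<close>
  have row: "(\<Sum>u\<in>V. pointer_row v (g v) u * y u) = 0" if v: "v \<in> V" for v
  proof -
    have "(\<Sum>u\<in>V. pointer_row v (g v) u * y u) =
      (\<Sum>u\<in>V. if u = v then y u else 0) - (\<Sum>u\<in>V. if u = g v then if g v \<noteq> v then y u else 0 else 0)"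
      unfolding sum_subtractf[symmetric] by (rule sum.cong) (auto simp: pointer_row_def)
    also have "\<dots> = y v - (if g v \<noteq> v then y (g v) else 0)"
      using fV v gV by (simp add: sum.delta')
    also have "\<dots> = 0" using y0 yg by auto
    finally show ?thesis .
  qed
  have "?M *\<^sub>v ?x = 0\<^sub>v N"
  proof (rule eq_vecI)
    fix i assume "i < dim_vec (0\<^sub>v N :: complex Matrix.vec)"
    then have i: "i < N" by simp
    have "vec_index (?M *\<^sub>v ?x) i = (\<Sum>j = 0..<N. pointer_row (e i) (g (e i)) (e j) * y (e j))"
      using i by (simp add: scalar_prod_def)
    also have "\<dots> = (\<Sum>u\<in>V. pointer_row (e i) (g (e i)) u * y u)"
      by (rule sum.reindex_bij_betw[OF e])
    finally show "vec_index (?M *\<^sub>v ?x) i = vec_index (0\<^sub>v N) i" using row eV i by simp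
  qed simp
  moreover have "?x \<noteq> 0\<^sub>v N"
  proof
    assume x: "?x = 0\<^sub>v N"
    obtain v where v: "v \<in> V" "y v = 1" using g by (auto simp: y_def)
    then obtain i where "i < N" "e i = v" using e by (auto simp: bij_betw_def)
    with arg_cong[OF x, of "\<lambda>z. vec_index z i"] v show False by simp
  qed
  ultimately show ?thesis
    by (subst det_0_iff_vec_prod_zero[of _ N]) (auto intro!: exI[of _ ?x])
qed

text \<open>Multilinearity is carried out inside the Leibniz sum: the product of the row sums
  becomes a sum over all choice maps, and exchanging it with the sum over permutations leaves one
  determinant, 0 or 1, per map.\<close>

theorem det_eq_card_rooted_maps:
  assumes e: "bij_betw e {0..<N} V" and B: "\<And>v. v \<in> V \<Longrightarrow> v \<in> B v \<and> B v \<subseteq> V"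
  shows "Determinant.det (Matrix.mat N N (\<lambda>(i, j).
            if e j = e i then of_nat (card (B (e i))) else if e j \<in> B (e i) then -1 else 0))
     = (of_nat (card (rooted_maps V B)) :: complex)"
proof -
  have fV: "finite V" using bij_betw_finite[OF e] by simp
  then have fB: "finite (B v)" if "v \<in> V" for v using B that finite_subset by blast
  have eV: "e i \<in> V" if "i < N" for i using e that by (auto simp: bij_betw_def)
  \<comment> \<open>The factor at index \<open>i\<close> involves \<open>p i\<close>. Expanding over
    maps on \<open>V\<close> needs factors indexed by vertices, so \<open>i\<close> is recovered as
    \<open>e' v\<close>.\<close>
  define e' where "e' = inv_into {0..<N} e"
  have e'e: "e' (e i) = i" if "i < N" for i
    using e that by (auto simp: e'_def bij_betw_def)
  let ?P = "{p. p permutes {0..<N}}"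
  let ?M = "\<lambda>g. Matrix.mat N N (\<lambda>(i, j). pointer_row (e i) (g (e i)) (e j))"
  have expand: "(\<Prod>i = 0..<N. \<Sum>w\<in>B (e i). pointer_row (e i) w (e (p i)))
      = (\<Sum>g\<in>PiE V B. \<Prod>i = 0..<N. pointer_row (e i) (g (e i)) (e (p i)))" for p
  proof -
    have "(\<Prod>i = 0..<N. \<Sum>w\<in>B (e i). pointer_row (e i) w (e (p i)))
       = (\<Prod>i = 0..<N. \<Sum>w\<in>B (e i). pointer_row (e i) w (e (p (e' (e i)))))"
      by (rule prod.cong) (auto simp: e'e)
    also have "\<dots> = (\<Prod>v\<in>V. \<Sum>w\<in>B v. pointer_row v w (e (p (e' v))))"
      by (rule prod.reindex_bij_betw[OF e])
    also have "\<dots> = (\<Sum>g\<in>PiE V B. \<Prod>v\<in>V. pointer_row v (g v) (e (p (e' v))))"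
      using fV fB by (rule prod_sum_PiE)
    also have "\<dots> = (\<Sum>g\<in>PiE V B. \<Prod>i = 0..<N. pointer_row (e i) (g (e i)) (e (p (e' (e i)))))"
      by (intro sum.cong refl prod.reindex_bij_betw[OF e, symmetric])
    also have "\<dots> = (\<Sum>g\<in>PiE V B. \<Prod>i = 0..<N. pointer_row (e i) (g (e i)) (e (p i)))"
      by (intro sum.cong refl prod.cong) (auto simp: e'e)
    finally show ?thesis .
  qed
  have "Determinant.det (Matrix.mat N N (\<lambda>(i, j).
            if e j = e i then of_nat (card (B (e i))) else if e j \<in> B (e i) then -1 else 0)) =
     Determinant.det (Matrix.mat N N (\<lambda>(i, j). \<Sum>w\<in>B (e i). pointer_row (e i) w (e j)))"
    by (rule arg_cong[of _ _ Determinant.det], rule cong_mat)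
       (use B eV fB in \<open>simp_all add: sum_pointer_row\<close>)
  also have "\<dots> = (\<Sum>p\<in>?P. signof p * (\<Prod>i = 0..<N. \<Sum>w\<in>B (e i). pointer_row (e i) w (e (p i))))"
    by (subst det_def'[of _ N]) (auto intro!: sum.cong prod.cong simp: permutes_in_image)
  also have "\<dots> = (\<Sum>g\<in>PiE V B. \<Sum>p\<in>?P. signof p * (\<Prod>i = 0..<N. pointer_row (e i) (g (e i)) (e (p i))))"
    unfolding expand sum_distrib_left by (rule sum.swap)
  also have "\<dots> = (\<Sum>g\<in>PiE V B. Determinant.det (?M g))"
    by (intro sum.cong refl, subst det_def'[of _ N])
       (auto intro!: sum.cong prod.cong simp: permutes_in_image)
  also have "\<dots> = (\<Sum>g\<in>PiE V B. if g \<in> rooted_maps V B then 1 else 0)"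
  proof (rule sum.cong[OF refl])
    fix g assume g: "g \<in> PiE V B"
    then have gV: "\<forall>v\<in>V. g v \<in> V" using B by (fastforce simp: PiE_def Pi_def)
    show "Determinant.det (?M g) = (if g \<in> rooted_maps V B then 1 else 0)"
      using det_pointer_matrix_rooted[OF e, of g] det_pointer_matrix_not_rooted[OF e gV] g
      unfolding rooted_maps_def by auto
  qed
  also have "\<dots> = of_nat (card (rooted_maps V B))"
  proof -
    have "finite (PiE V B)" using fV fB by (rule finite_PiE)
    moreover have "PiE V B \<inter> {g. g \<in> rooted_maps V B} = rooted_maps V B"
      by (auto simp: rooted_maps_def)
    ultimately show ?thesis by (simp add: sum.If_cases)
  qed
  finally show ?thesis .
qed

section \<open>Determinants of block circulant matrices\<close>

definition circulant_mat :: "nat \<Rightarrow> (int \<Rightarrow> complex) \<Rightarrow> complex Matrix.mat" where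
  "circulant_mat n f = Matrix.mat n n (\<lambda>(i, j). f ((int j - int i) mod int n))"

text \<open>The \<open>k\<close>-th character of the cyclic group, taken on all integers so that
  sums and negatives need no reduction; \<open>zmod_char_mod\<close> shows that it factors through
  residues.\<close>

definition zmod_char :: "nat \<Rightarrow> nat \<Rightarrow> int \<Rightarrow> complex" where
  "zmod_char n k d = cis (2 * pi * real k * real_of_int d / real n)"

text \<open>There is no conjugation, because circulant entries are indexed by column minus row: this
  is the eigenvalue belonging to column \<open>k\<close> of \<open>fourier_mat\<close>.\<close>

definition zmod_dft :: "nat \<Rightarrow> (int \<Rightarrow> complex) \<Rightarrow> nat \<Rightarrow> complex" where
  "zmod_dft n f k = (\<Sum>d = 0..<int n. f d * zmod_char n k d)"

definition fourier_mat :: "nat \<Rightarrow> complex Matrix.mat" where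
  "fourier_mat n = Matrix.mat n n (\<lambda>(i, k). zmod_char n k (int i))"

definition diagonal_of :: "nat \<Rightarrow> (nat \<Rightarrow> complex) \<Rightarrow> complex Matrix.mat" where
  "diagonal_of n f = Matrix.mat n n (\<lambda>(i, j). if i = j then f i else 0)"

lemma carrier_mats [simp]:
  "circulant_mat n f \<in> carrier_mat n n" "fourier_mat n \<in> carrier_mat n n"
  "diagonal_of n h \<in> carrier_mat n n"
  by (simp_all add: circulant_mat_def fourier_mat_def diagonal_of_def)

lemma zmod_char_add: "zmod_char n k (c + d) = zmod_char n k c * zmod_char n k d"
  by (simp add: zmod_char_def cis_mult ring_distribs add_divide_distrib)

lemma zmod_char_mod:
  assumes "0 < n"
  shows "zmod_char n k (d mod int n) = zmod_char n k d"
proof -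
  have "zmod_char n k (int n * (d div int n)) = cis (2 * pi * of_int (int k * (d div int n)))"
    unfolding zmod_char_def using assms by (simp add: field_simps)
  also have "\<dots> = 1" by (rule cis_multiple_2pi) (rule Ints_of_int)
  finally show ?thesis
    using zmod_char_add[of n k "d mod int n" "int n * (d div int n)"] by simp
qed

lemma bij_betw_shift_mod:
  assumes "0 < n"
  shows "bij_betw (\<lambda>j. (int j - c) mod int n) {0..<n} {0..<int n}"
proof (rule bij_betw_byWitness[where f' = "\<lambda>d. nat ((d + c) mod int n)"])
  show "\<forall>j\<in>{0..<n}. nat (((int j - c) mod int n + c) mod int n) = j"
    by (auto simp: mod_add_left_eq)
  show "\<forall>d\<in>{0..<int n}. (int (nat ((d + c) mod int n)) - c) mod int n = d"
    using assms by (auto simp: mod_diff_left_eq)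
  show "(\<lambda>d. nat ((d + c) mod int n)) ` {0..<int n} \<subseteq> {0..<n}"
    using assms by (auto simp: nat_less_iff)
qed (use assms in auto)

text \<open>The character at \<open>j\<close> is its value at \<open>i\<close> times its value at
  \<open>j - i\<close>, and the shift by \<open>i\<close> permutes the residues. One matrix thus
  diagonalises all circulants at once, which the block version relies on.\<close>

lemma circulant_mat_fourier_mat:
  assumes "0 < n"
  shows "circulant_mat n f * fourier_mat n = fourier_mat n * diagonal_of n (zmod_dft n f)"
proof (rule eq_matI)
  fix i k
  assume "i < dim_row (fourier_mat n * diagonal_of n (zmod_dft n f))"
    "k < dim_col (fourier_mat n * diagonal_of n (zmod_dft n f))"
  then have ik: "i < n" "k < n" by (simp_all add: fourier_mat_def diagonal_of_def)
  have "(circulant_mat n f * fourier_mat n) $$ (i, k)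
      = (\<Sum>j = 0..<n. f ((int j - int i) mod int n) * zmod_char n k (int j))"
    using ik by (simp add: circulant_mat_def fourier_mat_def scalar_prod_def)
  also have "\<dots> = (\<Sum>j = 0..<n. zmod_char n k (int i) * (f ((int j - int i) mod int n) *
       zmod_char n k ((int j - int i) mod int n)))"
  proof (rule sum.cong[OF refl])
    fix j
    have "zmod_char n k (int j) = zmod_char n k (int i) * zmod_char n k (int j - int i)"
      by (simp add: zmod_char_add[symmetric])
    then show "f ((int j - int i) mod int n) * zmod_char n k (int j) = zmod_char n k (int i) *
        (f ((int j - int i) mod int n) * zmod_char n k ((int j - int i) mod int n))"
      by (simp add: zmod_char_mod[OF assms])
  qed
  also have "\<dots> = zmod_char n k (int i) * zmod_dft n f k"
    unfolding zmod_dft_def sum_distrib_left[symmetric]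
    by (subst sum.reindex_bij_betw[OF bij_betw_shift_mod[OF assms], of "\<lambda>d. f d * zmod_char n k d"]) simp
  also have "\<dots> = (\<Sum>l = 0..<n. if l = k then zmod_char n l (int i) * zmod_dft n f l else 0)"
    using ik by simp
  also have "\<dots> = (\<Sum>l = 0..<n. zmod_char n l (int i) * (if l = k then zmod_dft n f l else 0))"
    by (rule sum.cong) auto
  also have "\<dots> = (fourier_mat n * diagonal_of n (zmod_dft n f)) $$ (i, k)"
    using ik by (simp add: diagonal_of_def fourier_mat_def scalar_prod_def)
  finally show "(circulant_mat n f * fourier_mat n) $$ (i, k) =
      (fourier_mat n * diagonal_of n (zmod_dft n f)) $$ (i, k)" .
qed (simp_all add: circulant_mat_def fourier_mat_def diagonal_of_def)

text \<open>For \<open>i\<close> and \<open>j\<close> distinct this is a geometric sum whose ratio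
  is an \<open>n\<close>-th root of unity other than 1.\<close>

lemma zmod_char_orthogonal:
  assumes "i < n" "j < n"
  shows "(\<Sum>k = 0..<n. zmod_char n k (int i - int j)) = (if i = j then of_nat n else 0)"
proof (cases "i = j")
  case False
  define x where "x = 2 * pi * real_of_int (int i - int j) / real n"
  have pow: "zmod_char n k (int i - int j) = cis x ^ k" for k
    by (simp add: zmod_char_def x_def Complex.DeMoivre mult_ac)
  have n1: "cis x ^ n = 1"
  proof -
    have "cis x ^ n = cis (2 * pi * real_of_int (int i - int j))"
      using assms by (simp add: Complex.DeMoivre x_def)
    also have "\<dots> = 1" by (rule cis_multiple_2pi) (rule Ints_of_int)
    finally show ?thesis .
  qed
  have "cis x \<noteq> 1"
  proof
    assume "cis x = 1"
    then have "cos x = 1" by (simp add: complex_eq_iff)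
    then obtain m :: int where "x = of_int m * 2 * pi" by (auto simp: cos_one_2pi_int)
    then have "(2 * pi) * real_of_int (int i - int j) = (2 * pi) * (of_int m * real n)"
      using assms by (simp add: x_def field_simps)
    then have "real_of_int (int i - int j) = of_int m * real n"
      by (subst (asm) mult_left_cancel) auto
    then have "int i - int j = m * int n"
      by (metis of_int_eq_iff of_int_mult of_int_of_nat_eq)
    then have "int n dvd int i - int j" by simp
    then have "int i mod int n = int j mod int n" by (simp add: mod_eq_dvd_iff)
    with assms False show False by simp
  qed
  then have "(\<Sum>k = 0..<n. cis x ^ k) = 0"
    using geometric_sum[of "cis x" n] n1 by (simp add: lessThan_atLeast0)
  then show ?thesis using False by (simp add: pow)
qed (simp add: zmod_char_def)

lemma det_fourier_mat_nonzero:
  assumes "0 < n"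
  shows "Determinant.det (fourier_mat n) \<noteq> 0"
proof -
  let ?G = "Matrix.mat n n (\<lambda>(k, j). zmod_char n k (- int j))"
  have "fourier_mat n * ?G = of_nat n \<cdot>\<^sub>m 1\<^sub>m n"
  proof (rule eq_matI)
    fix i j
    assume "i < dim_row (of_nat n \<cdot>\<^sub>m 1\<^sub>m n :: complex Matrix.mat)"
      "j < dim_col (of_nat n \<cdot>\<^sub>m 1\<^sub>m n :: complex Matrix.mat)"
    then have ij: "i < n" "j < n" by simp_all
    have "(fourier_mat n * ?G) $$ (i, j) = (\<Sum>k = 0..<n. zmod_char n k (int i) * zmod_char n k (- int j))"
      using ij by (simp add: fourier_mat_def scalar_prod_def)
    also have "\<dots> = (if i = j then of_nat n else 0)"
      using zmod_char_orthogonal[OF ij] by (simp add: zmod_char_add[symmetric])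
    finally show "(fourier_mat n * ?G) $$ (i, j) = (of_nat n \<cdot>\<^sub>m 1\<^sub>m n) $$ (i, j)"
      using ij by simp
  qed (simp_all add: fourier_mat_def)
  then have "Determinant.det (fourier_mat n) * Determinant.det ?G
      = Determinant.det (of_nat n \<cdot>\<^sub>m 1\<^sub>m n :: complex Matrix.mat)"
    by (subst det_mult[of _ n, symmetric]) auto
  also have "\<dots> = of_nat n ^ n" by simp
  also have "\<dots> \<noteq> 0" using assms by simp
  finally show ?thesis by auto
qed

lemma diagonal_of_mult:
  "diagonal_of n f * diagonal_of n g = diagonal_of n (\<lambda>i. f i * g i)"
proof (rule eq_matI)
  fix i j
  assume "i < dim_row (diagonal_of n (\<lambda>i. f i * g i))" "j < dim_col (diagonal_of n (\<lambda>i. f i * g i))"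
  then have ij: "i < n" "j < n" by (simp_all add: diagonal_of_def)
  have "(diagonal_of n f * diagonal_of n g) $$ (i, j)
      = (\<Sum>l = 0..<n. (if i = l then f i else 0) * (if l = j then g l else 0))"
    using ij by (simp add: diagonal_of_def scalar_prod_def)
  also have "\<dots> = (\<Sum>l = 0..<n. if l = i then (if i = j then f i * g i else 0) else 0)"
    by (rule sum.cong) auto
  finally show "(diagonal_of n f * diagonal_of n g) $$ (i, j) = diagonal_of n (\<lambda>i. f i * g i) $$ (i, j)"
    using ij by (simp add: diagonal_of_def)
qed (simp_all add: diagonal_of_def)

lemma det_diagonal_of: "Determinant.det (diagonal_of n f) = (\<Prod>i = 0..<n. f i)"
proof -
  have "Determinant.det (diagonal_of n f) = prod_list (diag_mat (diagonal_of n f))"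
    by (rule det_upper_triangular[of _ n]) (auto simp: diagonal_of_def upper_triangular_def)
  then show ?thesis by (simp add: prod_list_diag_prod diagonal_of_def)
qed

text \<open>Two copies of the Fourier matrix intertwine the block matrix with one made of four
  diagonal blocks. Cancelling the nonzero Fourier determinant gives equal determinants without
  forming an inverse.\<close>

theorem det_block_circulant:
  assumes "0 < n"
  shows "Determinant.det (four_block_mat (circulant_mat n a) (circulant_mat n c)
           (circulant_mat n c') (circulant_mat n b))
    = (\<Prod>k = 0..<n. zmod_dft n a k * zmod_dft n b k - zmod_dft n c k * zmod_dft n c' k)"
proof -
  let ?F = "fourier_mat n" and ?Z = "0\<^sub>m n n :: complex Matrix.mat"
  let ?D = "\<lambda>f. diagonal_of n (zmod_dft n f)"
  let ?M = "four_block_mat (circulant_mat n a) (circulant_mat n c) (circulant_mat n c') (circulant_mat n b)"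
  let ?N = "four_block_mat (?D a) (?D c) (?D c') (?D b)"
  let ?FF = "four_block_mat ?F ?Z ?Z ?F"
  have mz: "X * ?Z = ?Z" "?Z * X = ?Z" "X + ?Z = X" "?Z + X = X" if "X \<in> carrier_mat n n" for X
    using that by auto
  have cm: "A * B \<in> carrier_mat n n" if "A \<in> carrier_mat n n" "B \<in> carrier_mat n n"
    for A B :: "complex Matrix.mat" using that by simp
  have "?M * ?FF = ?FF * ?N"
    by (subst (1 2) mult_four_block_mat[where ?nr1.0 = n and ?nr2.0 = n and ?n1.0 = n and ?n2.0 = n and ?nc1.0 = n and ?nc2.0 = n])
       (simp_all add: mz cm circulant_mat_fourier_mat[OF assms])
  moreover have "?M \<in> carrier_mat (n + n) (n + n)" "?FF \<in> carrier_mat (n + n) (n + n)"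
    "?N \<in> carrier_mat (n + n) (n + n)" by simp_all
  ultimately have "Determinant.det ?M * Determinant.det ?FF = Determinant.det ?FF * Determinant.det ?N"
    by (metis det_mult)
  moreover have "Determinant.det ?FF = Determinant.det ?F * Determinant.det ?F"
    by (rule det_four_block_mat_upper_right_zero) auto
  ultimately have "Determinant.det ?M = Determinant.det ?N"
    using det_fourier_mat_nonzero[OF assms] by simp
  \<comment> \<open>Diagonal blocks commute, so the two-by-two determinant formula applies
    blockwise.\<close>
  also have "\<dots> = Determinant.det (?D a * ?D b - ?D c * ?D c')"
    by (rule det_four_block_mat[of _ n]) (simp_all add: diagonal_of_mult mult.commute)
  also have "?D a * ?D b - ?D c * ?D c' =
      diagonal_of n (\<lambda>k. zmod_dft n a k * zmod_dft n b k - zmod_dft n c k * zmod_dft n c' k)"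
    unfolding diagonal_of_mult by (rule eq_matI) (auto simp: diagonal_of_def)
  finally show ?thesis by (simp add: det_diagonal_of)
qed

section \<open>Rooted spanning forests of bicirculant graphs\<close>

lemma bij_betw_shift_mod_int:
  assumes "0 < n"
  shows "bij_betw (\<lambda>g. (g - h) mod int n) {0..<int n} {0..<int n}"
proof (rule bij_betw_byWitness[where f' = "\<lambda>d. (d + h) mod int n"])
  show "\<forall>g\<in>{0..<int n}. ((g - h) mod int n + h) mod int n = g"
    by (auto simp: mod_add_left_eq)
  show "\<forall>d\<in>{0..<int n}. ((d + h) mod int n - h) mod int n = d"
    by (auto simp: mod_diff_left_eq)
qed (use assms in auto)

lemma bij_betw_reflect_mod_int:
  assumes "0 < n"
  shows "bij_betw (\<lambda>g. (h - g) mod int n) {0..<int n} {0..<int n}"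
  by (rule bij_betw_byWitness[where f' = "\<lambda>d. (h - d) mod int n"])
     (use assms in \<open>auto simp: mod_diff_right_eq\<close>)

lemma card_bij_betw_preimage:
  assumes "bij_betw f A B" "X \<subseteq> B"
  shows "card {a \<in> A. f a \<in> X} = card X"
proof -
  have "f ` {a \<in> A. f a \<in> X} = X" using assms by (auto simp: bij_betw_def)
  moreover have "inj_on f {a \<in> A. f a \<in> X}"
    using assms(1) by (auto simp: bij_betw_def inj_on_def)
  ultimately show ?thesis by (metis card_image)
qed

definition mod_symmetric :: "nat \<Rightarrow> int set \<Rightarrow> bool" where
  "mod_symmetric n R \<longleftrightarrow> R \<subseteq> {1..<int n} \<and> (\<forall>d\<in>R. (- d) mod int n \<in> R)"

lemma mod_symmetric_swap:
  assumes "mod_symmetric n R"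
  shows "(h - g) mod int n \<in> R \<longleftrightarrow> (g - h) mod int n \<in> R"
proof -
  have "(g - h) mod int n \<in> R" if "(h - g) mod int n \<in> R" for g h
  proof -
    have "(- ((h - g) mod int n)) mod int n = (g - h) mod int n" by (simp add: mod_minus_eq)
    then show ?thesis using assms that unfolding mod_symmetric_def by metis
  qed
  then show ?thesis by blast
qed

text \<open>An edge inside a layer may be listed from either end; symmetry of \<open>R\<close> and
  \<open>T\<close> makes the difference test independent of the order. An edge between layers always
  takes the difference from the \<open>Inl\<close> end, whichever end is written first.\<close>

lemma bicirculant_edges:
  assumes "mod_symmetric n R" "mod_symmetric n T"
  defines "Z \<equiv> {0..<int n}"
  shows "{Inl h, Inl g} \<in> gedges (bicirculant n R T S) \<longleftrightarrow> h \<in> Z \<and> g \<in> Z \<and> (g - h) mod int n \<in> R"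
    "{Inr h, Inr g} \<in> gedges (bicirculant n R T S) \<longleftrightarrow> h \<in> Z \<and> g \<in> Z \<and> (g - h) mod int n \<in> T"
    "{Inl h, Inr g} \<in> gedges (bicirculant n R T S) \<longleftrightarrow> h \<in> Z \<and> g \<in> Z \<and> (g - h) mod int n \<in> S"
    "{Inr g, Inl h} \<in> gedges (bicirculant n R T S) \<longleftrightarrow> h \<in> Z \<and> g \<in> Z \<and> (g - h) mod int n \<in> S"
  using mod_symmetric_swap[OF assms(1)] mod_symmetric_swap[OF assms(2)]
  unfolding bicirculant_def Z_def by (auto simp: doubleton_eq_iff)

lemma mod_symmetric_0: "mod_symmetric n R \<Longrightarrow> 0 \<notin> R"
  by (auto simp: mod_symmetric_def)

lemma simple_edges_bicirculant:
  assumes "mod_symmetric n R" "mod_symmetric n T"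
  shows "simple_edges (bicirculant n R T S)"
  unfolding simple_edges_def
proof
  fix e assume "e \<in> gedges (bicirculant n R T S)"
  then consider h g where "e = {Inl h, Inl g}" "h \<in> {0..<int n}" "g \<in> {0..<int n}" "(g - h) mod int n \<in> R"
    | h g where "e = {Inr h, Inr g}" "h \<in> {0..<int n}" "g \<in> {0..<int n}" "(g - h) mod int n \<in> T"
    | h g where "e = {Inl h, Inr g}" "h \<in> {0..<int n}" "g \<in> {0..<int n}"
    unfolding bicirculant_def by auto
  then show "\<exists>u v. u \<noteq> v \<and> u \<in> gverts (bicirculant n R T S) \<and> v \<in> gverts (bicirculant n R T S) \<and> e = {u, v}"
  proof cases
    case 1
    then show ?thesis using mod_symmetric_0[OF assms(1)]
      by (intro exI[of _ "Inl h"] exI[of _ "Inl g"]) (auto simp: bicirculant_def)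
  next
    case 2
    then show ?thesis using mod_symmetric_0[OF assms(2)]
      by (intro exI[of _ "Inr h"] exI[of _ "Inr g"]) (auto simp: bicirculant_def)
  next
    case 3
    then show ?thesis
      by (intro exI[of _ "Inl h"] exI[of _ "Inr g"]) (auto simp: bicirculant_def)
  qed
qed

definition closed_nbhd :: "'a ugraph \<Rightarrow> 'a \<Rightarrow> 'a set" where
  "closed_nbhd G v = insert v {w \<in> gverts G. {v, w} \<in> gedges G}"

text \<open>Translation by \<open>h\<close> and reflection in \<open>h\<close> permute the residues,
  so the degree is the same throughout a layer. The reflection serves the \<open>Inr\<close> side,
  where the cross neighbours \<open>g\<close> satisfy a condition on \<open>h - g\<close>.\<close>

lemma card_closed_nbhd_bicirculant:
  assumes n: "0 < n" and R: "mod_symmetric n R" and T: "mod_symmetric n T" and S: "S \<subseteq> {0..<int n}"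
    and h: "h \<in> {0..<int n}"
  shows "card (closed_nbhd (bicirculant n R T S) (Inl h)) = card R + card S + 1"
    "card (closed_nbhd (bicirculant n R T S) (Inr h)) = card T + card S + 1"
proof -
  note E = bicirculant_edges[OF R T]
  let ?Z = "{0..<int n}"
  let ?NR = "{g \<in> ?Z. (g - h) mod int n \<in> R}" and ?NT = "{g \<in> ?Z. (g - h) mod int n \<in> T}"
  let ?NS = "{g \<in> ?Z. (g - h) mod int n \<in> S}" and ?NS' = "{g \<in> ?Z. (h - g) mod int n \<in> S}"
  have RZ: "R \<subseteq> ?Z" "T \<subseteq> ?Z" using R T by (auto simp: mod_symmetric_def)
  note c = card_bij_betw_preimage[OF bij_betw_shift_mod_int[OF n, of h]]
    card_bij_betw_preimage[OF bij_betw_reflect_mod_int[OF n, of h]]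
  have fin: "finite {g \<in> ?Z. P g}" for P by (rule finite_subset[of _ ?Z]) auto
  have ins: "card (insert v (A <+> B)) = card A + card B + 1" if "v \<notin> A <+> B" "finite A" "finite B"
    for v :: "int + int" and A B
    using card_insert_disjoint[OF finite_Plus[OF that(2,3)] that(1)] card_Plus[OF that(2,3)] by simp
  have V: "gverts (bicirculant n R T S) = ?Z <+> ?Z" by (simp add: bicirculant_def)
  have l: "closed_nbhd (bicirculant n R T S) (Inl h) = insert (Inl h) (?NR <+> ?NS)"
  proof (rule Set.set_eqI)
    fix v
    show "v \<in> closed_nbhd (bicirculant n R T S) (Inl h) \<longleftrightarrow> v \<in> insert (Inl h) (?NR <+> ?NS)"
      using h by (cases v) (auto simp: closed_nbhd_def V E)
  qed
  have li: "Inl h \<notin> ?NR <+> ?NS" using mod_symmetric_0[OF R] by auto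
  show "card (closed_nbhd (bicirculant n R T S) (Inl h)) = card R + card S + 1"
    unfolding l ins[OF li fin fin] c(1)[OF RZ(1)] c(1)[OF S] ..
  have r: "closed_nbhd (bicirculant n R T S) (Inr h) = insert (Inr h) (?NS' <+> ?NT)"
  proof (rule Set.set_eqI)
    fix v
    show "v \<in> closed_nbhd (bicirculant n R T S) (Inr h) \<longleftrightarrow> v \<in> insert (Inr h) (?NS' <+> ?NT)"
      using h by (cases v) (auto simp: closed_nbhd_def V E)
  qed
  have ri: "Inr h \<notin> ?NS' <+> ?NT" using mod_symmetric_0[OF T] by auto
  show "card (closed_nbhd (bicirculant n R T S) (Inr h)) = card T + card S + 1"
    unfolding r ins[OF ri fin fin] c(1)[OF RZ(2)] c(2)[OF S] by (simp only: add.commute)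
qed

definition char_sum :: "nat \<Rightarrow> nat \<Rightarrow> int set \<Rightarrow> complex" where
  "char_sum n k X = (\<Sum>d\<in>X. zmod_char n k d)"

lemma zmod_dft_neg_indicator:
  assumes "S \<subseteq> {0..<int n}"
  shows "zmod_dft n (\<lambda>d. if d \<in> S then -1 else 0) k = - char_sum n k S"
proof -
  have "zmod_dft n (\<lambda>d. if d \<in> S then -1 else 0) k
      = (\<Sum>d = 0..<int n. if d \<in> S then - zmod_char n k d else 0)"
    unfolding zmod_dft_def by (rule sum.cong) auto
  also have "\<dots> = (\<Sum>d\<in>S. - zmod_char n k d)"
    using assms by (subst sum.inter_restrict[symmetric]) (auto simp: Int_absorb1)
  finally show ?thesis by (simp add: char_sum_def sum_negf)
qed

text \<open>The lower left block is the transpose of the upper right one, so its symbol is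
  reflected. Its transform is the factor with \<open>z\<close> replaced by its inverse.\<close>

lemma zmod_dft_neg_indicator_reflect:
  assumes "0 < n" "S \<subseteq> {0..<int n}"
  shows "zmod_dft n (\<lambda>d. if (- d) mod int n \<in> S then -1 else 0) k = - (\<Sum>d\<in>S. zmod_char n k (- d))"
proof -
  have "zmod_dft n (\<lambda>d. if (- d) mod int n \<in> S then -1 else 0) k
     = (\<Sum>d = 0..<int n. (\<lambda>d. if d \<in> S then - zmod_char n k (- d) else 0) ((0 - d) mod int n))"
    unfolding zmod_dft_def
  proof (rule sum.cong[OF refl])
    fix d
    have "zmod_char n k (- ((- d) mod int n)) = zmod_char n k d"
      using zmod_char_mod[OF assms(1), of k "- ((- d) mod int n)"] zmod_char_mod[OF assms(1), of k d]
      by (simp add: mod_minus_eq)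
    then show "(if (- d) mod int n \<in> S then - 1 else 0) * zmod_char n k d
      = (\<lambda>d. if d \<in> S then - zmod_char n k (- d) else 0) ((0 - d) mod int n)" by simp
  qed
  also have "\<dots> = (\<Sum>d = 0..<int n. if d \<in> S then - zmod_char n k (- d) else 0)"
    by (rule sum.reindex_bij_betw[OF bij_betw_reflect_mod_int[OF assms(1), of 0]])
  also have "\<dots> = (\<Sum>d\<in>S. - zmod_char n k (- d))"
    using assms by (subst sum.inter_restrict[symmetric]) (auto simp: Int_absorb1)
  finally show ?thesis by (simp add: sum_negf)
qed

lemma zmod_dft_laplacian_symbol:
  assumes "0 < n" "mod_symmetric n R"
  shows "zmod_dft n (\<lambda>d. if d = 0 then c else if d \<in> R then -1 else 0) k = c - char_sum n k R"
proof -
  have R: "R \<subseteq> {0..<int n}" using assms by (auto simp: mod_symmetric_def)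
  have "zmod_dft n (\<lambda>d. if d = 0 then c else if d \<in> R then -1 else 0) k =
     (\<Sum>d = 0..<int n. (if d = 0 then c * zmod_char n k d else 0) +
        (if d \<in> R then -1 else 0) * zmod_char n k d)"
    unfolding zmod_dft_def by (rule sum.cong) (use mod_symmetric_0[OF assms(2)] in auto)
  also have "\<dots> = c * zmod_char n k 0 + zmod_dft n (\<lambda>d. if d \<in> R then -1 else 0) k"
    using assms(1) by (simp add: sum.distrib zmod_dft_def)
  finally show ?thesis using zmod_dft_neg_indicator[OF R] by (simp add: zmod_char_def)
qed

theorem num_rooted_spanning_forests_bicirculant:
  assumes n: "0 < n" and R: "mod_symmetric n R" and T: "mod_symmetric n T" and S: "S \<subseteq> {0..<int n}"
  shows "of_nat (num_rooted_spanning_forests (bicirculant n R T S)) =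
    (\<Prod>k = 0..<n. (of_nat (card R + card S + 1) - char_sum n k R) *
         (of_nat (card T + card S + 1) - char_sum n k T)
       - char_sum n k S * (\<Sum>d\<in>S. zmod_char n k (- d)))"
proof -
  let ?G = "bicirculant n R T S"
  let ?Z = "{0..<int n}"
  note E = bicirculant_edges[OF R T]
  have V: "gverts ?G = ?Z <+> ?Z" by (simp add: bicirculant_def)
  \<comment> \<open>Listing one whole layer before the other splits \<open>I + L\<close> into four
    circulant blocks.\<close>
  define e :: "nat \<Rightarrow> int + int" where "e i = (if i < n then Inl (int i) else Inr (int i - int n))" for i
  have e: "bij_betw e {0..<n + n} (gverts ?G)"
    unfolding V
    by (rule bij_betw_byWitness[where f' = "\<lambda>v. case v of Inl h \<Rightarrow> nat h | Inr g \<Rightarrow> n + nat g"])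
       (auto simp: e_def split: sum.splits)
  let ?a = "\<lambda>d. if d = 0 then of_nat (card R + card S + 1) else if d \<in> R then -1 else 0 :: complex"
  let ?b = "\<lambda>d. if d = 0 then of_nat (card T + card S + 1) else if d \<in> T then -1 else 0 :: complex"
  let ?c = "\<lambda>d. if d \<in> S then -1 else 0 :: complex"
  let ?c' = "\<lambda>d. if (- d) mod int n \<in> S then -1 else 0 :: complex"
  let ?L = "Matrix.mat (n + n) (n + n) (\<lambda>(i, j).
     if e j = e i then of_nat (card (closed_nbhd ?G (e i)))
     else if e j \<in> closed_nbhd ?G (e i) then -1 else 0 :: complex)"
  let ?F = "four_block_mat (circulant_mat n ?a) (circulant_mat n ?c) (circulant_mat n ?c') (circulant_mat n ?b)"
  have mod0: "(int j - int i) mod int n = 0 \<longleftrightarrow> i = j" if "i < n" "j < n" for i j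
  proof
    assume "(int j - int i) mod int n = 0"
    then have "int j mod int n = int i mod int n" by (simp add: mod_eq_dvd_iff mod_eq_0_iff_dvd)
    then show "i = j" using that by simp
  qed simp
  have "num_rooted_spanning_forests ?G = card (rooted_maps (gverts ?G) (closed_nbhd ?G))"
    unfolding closed_nbhd_def
    by (rule num_rooted_spanning_forests_eq[OF simple_edges_bicirculant[OF R T]])
  then have "of_nat (num_rooted_spanning_forests ?G) = Determinant.det ?L"
    by (subst det_eq_card_rooted_maps[OF e]) (auto simp: closed_nbhd_def)
  also have "?L = ?F"
  proof (rule eq_matI)
    fix i j assume "i < dim_row ?F" "j < dim_col ?F"
    then have ij: "i < n + n" "j < n + n" by (simp_all add: circulant_mat_def)
    have eV: "e i \<in> gverts ?G" "e j \<in> gverts ?G" using e ij by (auto simp: bij_betw_def)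
    have nb: "e j \<in> closed_nbhd ?G (e i) \<longleftrightarrow> e j = e i \<or> {e i, e j} \<in> gedges ?G"
      using eV by (auto simp: closed_nbhd_def)
    have L: "?L $$ (i, j) = (if e j = e i then of_nat (card (closed_nbhd ?G (e i)))
       else if {e i, e j} \<in> gedges ?G then -1 else 0)"
      using ij nb by simp
    note card = card_closed_nbhd_bicirculant[OF n R T S]
    consider "i < n" "j < n" | "i < n" "\<not> j < n" | "\<not> i < n" "j < n" | "\<not> i < n" "\<not> j < n" by blast
    then show "?L $$ (i, j) = ?F $$ (i, j)"
    proof cases
      case 1
      then show ?thesis unfolding L using mod0[of i j] card(1)[of "int i"] card(1)[of "int j"]
        by (simp add: e_def E circulant_mat_def)
    next
      case 2
      then show ?thesis unfolding L using ij
        by (simp add: e_def E circulant_mat_def of_nat_diff)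
    next
      case 3
      \<comment> \<open>In the lower left block the row vertex is the \<open>Inr\<close> end, so the
        difference tested by the edge is the negative of the circulant index.\<close>
      have "(- ((int j - (int i - int n)) mod int n)) mod int n = (int i - int n - int j) mod int n"
        by (simp add: mod_minus_eq)
      then show ?thesis unfolding L using ij 3
        by (simp add: e_def E circulant_mat_def of_nat_diff)
    next
      case 4
      have "i - n = j - n \<longleftrightarrow> i = j" using 4 by (simp add: eq_diff_iff)
      then show ?thesis unfolding L using ij 4 mod0[of "i - n" "j - n"] card(2)[of "int i - int n"] card(2)[of "int j - int n"]
        by (simp add: e_def E circulant_mat_def of_nat_diff)
    qed
  qed (simp_all add: circulant_mat_def)
  finally show ?thesis
    unfolding det_block_circulant[OF n] zmod_dft_laplacian_symbol[OF n R] zmod_dft_laplacian_symbol[OF n T]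
      zmod_dft_neg_indicator[OF S] zmod_dft_neg_indicator_reflect[OF n S] by simp
qed

section \<open>Equidistant sums of smooth functions\<close>

text \<open>Asked on the whole line, so that the ends of the unit interval need no one-sided
  derivatives.\<close>

definition twice_smooth :: "(real \<Rightarrow> real) \<Rightarrow> bool" where
  "twice_smooth h \<longleftrightarrow> (\<exists>h' h''. (\<forall>x. (h has_real_derivative h' x) (at x)) \<and>
     (\<forall>x. (h' has_real_derivative h'' x) (at x)) \<and> continuous_on UNIV h'')"

lemma twice_smoothI:
  assumes "\<And>x. (h has_real_derivative h' x) (at x)" "\<And>x. (h' has_real_derivative h'' x) (at x)"
    "continuous_on UNIV h''"
  shows "twice_smooth h"
  using assms unfolding twice_smooth_def by blast

section \<open>Closure properties of twice smooth functions\<close>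

lemma twice_smooth_const: "twice_smooth (\<lambda>_. c)"
  by (rule twice_smoothI[of _ "\<lambda>_. 0" "\<lambda>_. 0"]) auto

lemma twice_smooth_cos: "twice_smooth (\<lambda>x. cos (c * x))"
  by (rule twice_smoothI[of _ "\<lambda>x. - c * sin (c * x)" "\<lambda>x. - c * (c * cos (c * x))"])
     (auto intro!: derivative_eq_intros continuous_intros)

lemma twice_smooth_sin: "twice_smooth (\<lambda>x. sin (c * x))"
  by (rule twice_smoothI[of _ "\<lambda>x. c * cos (c * x)" "\<lambda>x. - c * (c * sin (c * x))"])
     (auto intro!: derivative_eq_intros continuous_intros)

lemma has_derivative_imp_continuous_UNIV:
  "(\<And>x. (f has_real_derivative f' x) (at x)) \<Longrightarrow> continuous_on UNIV f"
  by (meson DERIV_isCont continuous_at_imp_continuous_on)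

lemma twice_smooth_add:
  assumes "twice_smooth f" "twice_smooth g"
  shows "twice_smooth (\<lambda>x. f x + g x)"
proof -
  obtain f' f'' g' g'' where
    "\<And>x. (f has_real_derivative f' x) (at x)" "\<And>x. (f' has_real_derivative f'' x) (at x)"
    "continuous_on UNIV f''"
    "\<And>x. (g has_real_derivative g' x) (at x)" "\<And>x. (g' has_real_derivative g'' x) (at x)"
    "continuous_on UNIV g''"
    using assms unfolding twice_smooth_def by blast
  then show ?thesis
    by (intro twice_smoothI[of _ "\<lambda>x. f' x + g' x" "\<lambda>x. f'' x + g'' x"])
       (auto intro!: derivative_intros continuous_intros)
qed

lemma twice_smooth_mult:
  assumes "twice_smooth f" "twice_smooth g"
  shows "twice_smooth (\<lambda>x. f x * g x)"
proof -
  obtain f' f'' g' g'' where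
    *: "\<And>x. (f has_real_derivative f' x) (at x)" "\<And>x. (f' has_real_derivative f'' x) (at x)"
    "continuous_on UNIV f''"
    "\<And>x. (g has_real_derivative g' x) (at x)" "\<And>x. (g' has_real_derivative g'' x) (at x)"
    "continuous_on UNIV g''"
    using assms unfolding twice_smooth_def by blast
  note c = *(3,6) has_derivative_imp_continuous_UNIV[OF *(1)] has_derivative_imp_continuous_UNIV[OF *(2)]
    has_derivative_imp_continuous_UNIV[OF *(4)] has_derivative_imp_continuous_UNIV[OF *(5)]
  show ?thesis
  proof (rule twice_smoothI[of _ "\<lambda>x. f' x * g x + f x * g' x"
        "\<lambda>x. (f'' x * g x + f' x * g' x) + (f' x * g' x + f x * g'' x)"])
    fix x
    show "((\<lambda>x. f x * g x) has_real_derivative f' x * g x + f x * g' x) (at x)"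
      using DERIV_mult[OF *(1)[of x] *(4)[of x]] by (simp add: algebra_simps)
    show "((\<lambda>x. f' x * g x + f x * g' x) has_real_derivative
        (f'' x * g x + f' x * g' x) + (f' x * g' x + f x * g'' x)) (at x)"
      using DERIV_add[OF DERIV_mult[OF *(2)[of x] *(4)[of x]] DERIV_mult[OF *(1)[of x] *(5)[of x]]]
      by (simp add: algebra_simps)
  qed (intro continuous_intros c)
qed

lemma twice_smooth_diff:
  assumes "twice_smooth f" "twice_smooth g"
  shows "twice_smooth (\<lambda>x. f x - g x)"
  using twice_smooth_add[OF assms(1) twice_smooth_mult[OF twice_smooth_const[of "-1"] assms(2)]]
  by simp

lemma twice_smooth_sum:
  assumes "\<And>i. i \<in> S \<Longrightarrow> twice_smooth (f i)"
  shows "twice_smooth (\<lambda>x. \<Sum>i\<in>S. f i x)"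
  using assms
  by (induction S rule: infinite_finite_induct) (auto intro: twice_smooth_const twice_smooth_add)

lemma twice_smooth_ln:
  assumes "twice_smooth f" "\<And>x. 0 < f x"
  shows "twice_smooth (\<lambda>x. ln (f x))"
proof -
  obtain f' f'' where
    *: "\<And>x. (f has_real_derivative f' x) (at x)" "\<And>x. (f' has_real_derivative f'' x) (at x)"
    "continuous_on UNIV f''"
    using assms unfolding twice_smooth_def by blast
  have nz: "f x \<noteq> 0" for x using assms(2)[of x] by simp
  show ?thesis
  proof (rule twice_smoothI[of _ "\<lambda>x. f' x / f x" "\<lambda>x. (f'' x * f x - f' x * f' x) / (f x * f x)"])
    fix x
    show "((\<lambda>x. ln (f x)) has_real_derivative f' x / f x) (at x)"
      using DERIV_chain2[OF DERIV_ln_divide[OF assms(2)] *(1)] by simp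
    show "((\<lambda>x. f' x / f x) has_real_derivative (f'' x * f x - f' x * f' x) / (f x * f x)) (at x)"
      by (rule DERIV_divide[OF *(2) *(1) nz])
  qed (intro continuous_intros *(3) has_derivative_imp_continuous_UNIV[OF *(1)]
         has_derivative_imp_continuous_UNIV[OF *(2)]; simp add: nz)
qed

lemma twice_smooth_continuous: "twice_smooth f \<Longrightarrow> continuous_on S f"
  unfolding twice_smooth_def
  by (meson has_derivative_imp_continuous_UNIV continuous_on_subset subset_UNIV)

section \<open>Second-order quadrature\<close>

text \<open>Taylor's formula with Lagrange remainder; compactness bounds the second derivative by
  one \<open>K\<close> for all base points, and the factor 1/2 is given away.\<close>

lemma twice_smooth_linear_approx:
  assumes "twice_smooth h"
  shows "\<exists>h' K. 0 \<le> K \<and> (\<forall>a\<in>{0..1}. \<forall>x\<in>{0..1}. \<bar>h x - (h a + h' a * (x - a))\<bar> \<le> K * (x - a)\<^sup>2)"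
proof -
  obtain h' h'' where
    *: "\<And>x. (h has_real_derivative h' x) (at x)" "\<And>x. (h' has_real_derivative h'' x) (at x)"
    "continuous_on UNIV h''"
    using assms unfolding twice_smooth_def by blast
  have "bounded (h'' ` {0..1})"
    by (intro compact_imp_bounded compact_continuous_image continuous_on_subset[OF *(3)]) auto
  then obtain K where K: "0 < K" "\<And>x. x \<in> {0..1} \<Longrightarrow> \<bar>h'' x\<bar> \<le> K"
    unfolding bounded_pos by auto
  have "\<bar>h x - (h a + h' a * (x - a))\<bar> \<le> K * (x - a)\<^sup>2" if ax: "a \<in> {0..1}" "x \<in> {0..1}" for a x
  proof (cases "x = a")
    case False
    let ?d = "\<lambda>m::nat. if m = 0 then h else if m = 1 then h' else h''"
    have "\<exists>t. (if x < a then x < t \<and> t < a else a < t \<and> t < x) \<and>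
       h x = (\<Sum>m<2. (?d m a / fact m) * (x - a) ^ m) + (?d 2 t / fact 2) * (x - a) ^ 2"
      by (rule Taylor[of 2 ?d h 0 1]) (use * ax False in \<open>auto simp: less_2_cases_iff\<close>)
    then obtain t where t: "if x < a then x < t \<and> t < a else a < t \<and> t < x"
      "h x = (\<Sum>m<2. (?d m a / fact m) * (x - a) ^ m) + (?d 2 t / fact 2) * (x - a) ^ 2" by blast
    have "t \<in> {0..1}" using t(1) ax by (auto split: if_splits)
    then have "\<bar>h'' t / 2\<bar> \<le> K" using K(2)[of t] K(1) by simp
    then have "\<bar>h'' t / 2\<bar> * (x - a)\<^sup>2 \<le> K * (x - a)\<^sup>2" by (rule mult_right_mono) simp
    moreover have "h x - (h a + h' a * (x - a)) = (h'' t / 2) * (x - a)\<^sup>2"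
      using t(2) by (simp add: numeral_2_eq_2)
    ultimately show ?thesis by (simp only: abs_mult abs_power2)
  qed simp
  then show ?thesis using K(1) by (intro exI[of _ h'] exI[of _ K]) auto
qed

text \<open>The linear part integrates exactly, and what remains is at most
  \<open>K * d\<^sup>2\<close> on an interval of length \<open>d\<close>.\<close>

lemma integral_linear_approx:
  fixes h :: "real \<Rightarrow> real"
  assumes h: "continuous_on {a..a + d} h" and d: "0 \<le> d" "0 \<le> K"
    and b: "\<And>x. x \<in> {a..a + d} \<Longrightarrow> \<bar>h x - (h a + c * (x - a))\<bar> \<le> K * (x - a)\<^sup>2"
  shows "\<bar>integral {a..a + d} h - (d * h a + c * d\<^sup>2 / 2)\<bar> \<le> K * d ^ 3"
proof -
  let ?F = "\<lambda>x. h a * x + c * (x - a)\<^sup>2 / 2"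
  have "((\<lambda>x. h a + c * (x - a)) has_integral (?F (a + d) - ?F a)) {a..a + d}"
    using d by (intro fundamental_theorem_of_calculus)
      (auto intro!: derivative_eq_intros simp flip: has_real_derivative_iff_has_vector_derivative)
  moreover have "?F (a + d) - ?F a = d * h a + c * d\<^sup>2 / 2" by (simp add: algebra_simps)
  moreover have "(h has_integral integral {a..a + d} h) {a..a + d}"
    using integrable_continuous_real[OF h] by (rule integrable_integral)
  ultimately have I: "((\<lambda>x. h x - (h a + c * (x - a))) has_integral
      (integral {a..a + d} h - (d * h a + c * d\<^sup>2 / 2))) {a..a + d}"
    using has_integral_diff by metis
  have "norm (integral {a..a + d} h - (d * h a + c * d\<^sup>2 / 2)) \<le> (K * d\<^sup>2) * Henstock_Kurzweil_Integration.content {a..a + d}"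
  proof (rule has_integral_bound_real[OF _ finite.emptyI I])
    fix x assume "x \<in> {a..a + d} - {}"
    then have x: "x \<in> {a..a + d}" by simp
    have "K * (x - a)\<^sup>2 \<le> K * d\<^sup>2" using x d by (intro mult_left_mono power_mono) auto
    then show "norm (h x - (h a + c * (x - a))) \<le> K * d\<^sup>2" using b[OF x] by simp
  qed (use d in auto)
  then show ?thesis using d by (simp add: power3_eq_cube power2_eq_square mult_ac)
qed

lemma integral_unit_partition:
  fixes h :: "real \<Rightarrow> real"
  assumes h: "continuous_on {0..1} h" and m: "0 < m"
  shows "integral {0..1} h = (\<Sum>k<m. integral {real k / m..real k / m + 1 / m} h)"
proof -
  have "integral {0..real j / m} h = (\<Sum>k<j. integral {real k / m..real k / m + 1 / m} h)"
    if "j \<le> m" for j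
    using that
  proof (induction j)
    case (Suc j)
    have le: "real (Suc j) / m \<le> 1" "real j / m \<le> real (Suc j) / m"
      using Suc m by (auto simp: field_simps)
    have "integral {0..real j / m} h + integral {real j / m..real (Suc j) / m} h
        = integral {0..real (Suc j) / m} h"
      using le by (intro Henstock_Kurzweil_Integration.integral_combine integrable_continuous_real
          continuous_on_subset[OF h]) auto
    then show ?case using Suc by (simp add: add_divide_distrib add.commute)
  qed simp
  from this[of m] show ?thesis using m by simp
qed

text \<open>\<open>h a + h' a * d / 2\<close> is the mean of the linear approximation over a cell,
  so any rule \<open>q\<close> matching it to second order errs by at most
  \<open>2 * K / m ^ 3\<close> per cell. Summing \<open>m\<close> cells and rescaling by
  \<open>m\<close> leaves \<open>2 * K / m\<close>. Condition \<open>Q\<close> ranges over all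
  \<open>h'\<close> and \<open>K\<close> because the actual pair is only obtained inside the
  proof.\<close>

lemma equidistant_sum_tendsto:
  assumes h: "twice_smooth h"
    and Q: "\<And>h' K. 0 \<le> K \<Longrightarrow>
      (\<And>a x. a \<in> {0..1} \<Longrightarrow> x \<in> {0..1} \<Longrightarrow> \<bar>h x - (h a + h' a * (x - a))\<bar> \<le> K * (x - a)\<^sup>2) \<Longrightarrow>
      (\<And>a d. 0 \<le> a \<Longrightarrow> 0 \<le> d \<Longrightarrow> a + d \<le> 1 \<Longrightarrow> \<bar>q a d - (h a + h' a * d / 2)\<bar> \<le> K * d\<^sup>2)"
  shows "(\<lambda>m. (\<Sum>k<m. q (real k / m) (1 / m)) - m * integral {0..1} h) \<longlonglongrightarrow> 0"
proof -
  obtain h' K where K: "0 \<le> K"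
    "\<And>a x. a \<in> {0..1} \<Longrightarrow> x \<in> {0..1} \<Longrightarrow> \<bar>h x - (h a + h' a * (x - a))\<bar> \<le> K * (x - a)\<^sup>2"
    using twice_smooth_linear_approx[OF h] by blast
  have "\<bar>(\<Sum>k<m. q (real k / m) (1 / m)) - m * integral {0..1} h\<bar> \<le> 2 * K / m" if m: "0 < m" for m :: nat
  proof -
    let ?d = "1 / real m"
    have loc: "\<bar>?d * q (real k / m) ?d - integral {real k / m..real k / m + ?d} h\<bar> \<le> 2 * K * ?d ^ 3"
      if "k < m" for k
    proof -
      let ?a = "real k / m"
      have a: "0 \<le> ?a" "?a + ?d \<le> 1" "0 \<le> ?d" using that m by (auto simp: field_simps)
      have "\<bar>integral {?a..?a + ?d} h - (?d * h ?a + h' ?a * ?d\<^sup>2 / 2)\<bar> \<le> K * ?d ^ 3"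
      proof (rule integral_linear_approx)
        fix x assume "x \<in> {?a..?a + ?d}"
        then have "x \<in> {0..1}" using a(1,2) unfolding atLeastAtMost_iff by linarith
        moreover have "?a \<in> {0..1}" using that m by simp
        ultimately show "\<bar>h x - (h ?a + h' ?a * (x - ?a))\<bar> \<le> K * (x - ?a)\<^sup>2" by (intro K(2))
      qed (use twice_smooth_continuous[OF h] a K in auto)
      moreover have "\<bar>?d * q ?a ?d - (?d * h ?a + h' ?a * ?d\<^sup>2 / 2)\<bar> \<le> K * ?d ^ 3"
      proof -
        have "?d * q ?a ?d - (?d * h ?a + h' ?a * ?d\<^sup>2 / 2) = ?d * (q ?a ?d - (h ?a + h' ?a * ?d / 2))"
          by (simp only: power2_eq_square) (simp add: algebra_simps)
        then have "\<bar>?d * q ?a ?d - (?d * h ?a + h' ?a * ?d\<^sup>2 / 2)\<bar>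
            = ?d * \<bar>q ?a ?d - (h ?a + h' ?a * ?d / 2)\<bar>" using a(3) by (simp only: abs_mult abs_of_nonneg)
        also have "\<dots> \<le> ?d * (K * ?d\<^sup>2)"
          using Q[of K h' ?a ?d] K a by (intro mult_left_mono) auto
        also have "\<dots> = K * ?d ^ 3" by (simp add: power3_eq_cube power2_eq_square)
        finally show ?thesis .
      qed
      ultimately show ?thesis by linarith
    qed
    have "\<bar>(\<Sum>k<m. ?d * q (real k / m) ?d) - integral {0..1} h\<bar>
      = \<bar>\<Sum>k<m. ?d * q (real k / m) ?d - integral {real k / m..real k / m + ?d} h\<bar>"
      using integral_unit_partition[OF twice_smooth_continuous[OF h] m] by (simp add: sum_subtractf)
    also have "\<dots> \<le> (\<Sum>k<m. 2 * K * ?d ^ 3)"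
      by (rule order.trans[OF sum_abs sum_mono]) (rule loc, simp)
    also have "\<dots> = m * (2 * K * ?d ^ 3)" by simp
    finally have "m * \<bar>(\<Sum>k<m. ?d * q (real k / m) ?d) - integral {0..1} h\<bar> \<le> m * (m * (2 * K * ?d ^ 3))"
      by (rule mult_left_mono) simp
    moreover have "m * \<bar>(\<Sum>k<m. ?d * q (real k / m) ?d) - integral {0..1} h\<bar>
        = \<bar>(\<Sum>k<m. q (real k / m) ?d) - m * integral {0..1} h\<bar>"
    proof -
      have "m * \<bar>(\<Sum>k<m. ?d * q (real k / m) ?d) - integral {0..1} h\<bar>
        = \<bar>m * ((\<Sum>k<m. ?d * q (real k / m) ?d) - integral {0..1} h)\<bar>"
        by (simp add: abs_mult)
      also have "m * ((\<Sum>k<m. ?d * q (real k / m) ?d) - integral {0..1} h)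
        = (\<Sum>k<m. q (real k / m) ?d) - m * integral {0..1} h"
        using m by (simp add: right_diff_distrib flip: sum_divide_distrib)
      finally show ?thesis .
    qed
    moreover have "m * (m * (2 * K * ?d ^ 3)) = 2 * K / m" using m by (simp add: power3_eq_cube)
    ultimately show ?thesis by simp
  qed
  then have "\<forall>\<^sub>F m in sequentially.
      norm ((\<Sum>k<m. q (real k / m) (1 / m)) - m * integral {0..1} h) \<le> 2 * K / real m"
    by (intro eventually_sequentiallyI[of 1]) auto
  moreover have "(\<lambda>m. 2 * K / real m) \<longlonglongrightarrow> 0" by (rule lim_const_over_n)
  ultimately show ?thesis by (rule Lim_null_comparison)
qed

lemma midpoint_sum_tendsto:
  assumes "twice_smooth h"
  shows "(\<lambda>m. (\<Sum>k<m. h ((real k + 1 / 2) / m)) - m * integral {0..1} h) \<longlonglongrightarrow> 0"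
proof -
  have "(\<lambda>m. (\<Sum>k<m. h (real k / m + (1 / m) / 2)) - m * integral {0..1} h) \<longlonglongrightarrow> 0"
  proof (rule equidistant_sum_tendsto[OF assms, where q = "\<lambda>a d. h (a + d / 2)"])
    fix h' :: "real \<Rightarrow> real" and K a d :: real
    assume *: "0 \<le> K" "\<And>a x. a \<in> {0..1} \<Longrightarrow> x \<in> {0..1} \<Longrightarrow> \<bar>h x - (h a + h' a * (x - a))\<bar> \<le> K * (x - a)\<^sup>2"
      "0 \<le> a" "0 \<le> d" "a + d \<le> 1"
    have "\<bar>h (a + d / 2) - (h a + h' a * d / 2)\<bar> \<le> K * (d / 2)\<^sup>2"
      using *(2)[of a "a + d / 2"] *(3-5) by simp
    also have "\<dots> \<le> K * d\<^sup>2" using * by (intro mult_left_mono power_mono) auto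
    finally show "\<bar>h (a + d / 2) - (h a + h' a * d / 2)\<bar> \<le> K * d\<^sup>2" .
  qed
  then show ?thesis by (simp add: add_divide_distrib mult.commute)
qed

text \<open>Left endpoints alone would leave the constant \<open>(h 0 - h 1) / 2\<close> in the
  limit. Equal end values make the left and right sums agree by telescoping, so both equal the
  trapezoid sum.\<close>

lemma periodic_sum_tendsto:
  assumes "twice_smooth h" "h 0 = h 1"
  shows "(\<lambda>m. (\<Sum>k<m. h (real k / m)) - m * integral {0..1} h) \<longlonglongrightarrow> 0"
proof -
  have "(\<lambda>m. (\<Sum>k<m. (h (real k / m) + h (real k / m + 1 / m)) / 2) - m * integral {0..1} h) \<longlonglongrightarrow> 0"
  proof (rule equidistant_sum_tendsto[OF assms(1), where q = "\<lambda>a d. (h a + h (a + d)) / 2"])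
    fix h' :: "real \<Rightarrow> real" and K a d :: real
    assume *: "0 \<le> K" "\<And>a x. a \<in> {0..1} \<Longrightarrow> x \<in> {0..1} \<Longrightarrow> \<bar>h x - (h a + h' a * (x - a))\<bar> \<le> K * (x - a)\<^sup>2"
      "0 \<le> a" "0 \<le> d" "a + d \<le> 1"
    have "\<bar>h (a + d) - (h a + h' a * d)\<bar> \<le> K * d\<^sup>2"
      using *(2)[of a "a + d"] *(3-5) by simp
    then have "\<bar>(h (a + d) - (h a + h' a * d)) / 2\<bar> \<le> K * d\<^sup>2"
      unfolding abs_divide by simp
    moreover have "(h a + h (a + d)) / 2 - (h a + h' a * d / 2) = (h (a + d) - (h a + h' a * d)) / 2"
      by (simp add: field_simps)
    ultimately show "\<bar>(h a + h (a + d)) / 2 - (h a + h' a * d / 2)\<bar> \<le> K * d\<^sup>2" by metis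
  qed
  moreover have "(\<Sum>k<m. (h (real k / m) + h (real k / m + 1 / m)) / 2) = (\<Sum>k<m. h (real k / m))" for m
  proof (cases "m = 0")
    case False
    have "(\<Sum>k<m. h (real (Suc k) / m) - h (real k / m)) = h (real m / m) - h (real 0 / m)"
      by (rule sum_lessThan_telescope)
    then have "(\<Sum>k<m. h (real k / m + 1 / m)) = (\<Sum>k<m. h (real k / m))"
      using assms(2) False by (simp add: sum_subtractf add_divide_distrib add.commute)
    then show ?thesis by (simp add: sum.distrib flip: sum_divide_distrib)
  qed simp
  ultimately show ?thesis by simp
qed

lemma prod_over_exp_tendsto:
  assumes "\<And>x. 0 < g x" "(\<lambda>m. (\<Sum>k<m. ln (g (c m k))) - real m * I) \<longlonglongrightarrow> 0"
  shows "(\<lambda>m. (\<Prod>k<m. g (c m k)) / exp I ^ m) \<longlonglongrightarrow> (1 :: real)"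
proof -
  have "(\<Prod>k<m. g (c m k)) / exp I ^ m = exp ((\<Sum>k<m. ln (g (c m k))) - real m * I)" for m
    using assms(1) by (simp add: exp_diff exp_sum exp_of_nat_mult)
  then show ?thesis using tendsto_exp[OF assms(2)] by simp
qed

section \<open>Values on the unit circle and asymptotics\<close>

definition cos_sum :: "nat \<Rightarrow> (nat \<Rightarrow> int) \<Rightarrow> real \<Rightarrow> real" where
  "cos_sum r \<alpha> x = (\<Sum>j = 1..r. 2 * cos (2 * pi * of_int (\<alpha> j) * x))"

text \<open>The squared modulus of the polynomial C on the unit circle, written through real and
  imaginary parts so that smoothness follows from closure properties.\<close>

definition cis_sum_sq :: "nat \<Rightarrow> (nat \<Rightarrow> int) \<Rightarrow> real \<Rightarrow> real" where
  "cis_sum_sq s \<gamma> x = (\<Sum>j = 1..s. cos (2 * pi * of_int (\<gamma> j) * x)) * (\<Sum>j = 1..s. cos (2 * pi * of_int (\<gamma> j) * x))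
     + (\<Sum>j = 1..s. sin (2 * pi * of_int (\<gamma> j) * x)) * (\<Sum>j = 1..s. sin (2 * pi * of_int (\<gamma> j) * x))"

text \<open>The shifts \<open>\<delta>, \<epsilon> \<in> {0, 2}\<close> select among $P_1, \dots, P_4$; at odd frequencies the
  involution \<open>n/2\<close> adds 1 to the degree and contributes the character value -1, hence the shift 2.\<close>

definition circle_symbol ::
  "nat \<Rightarrow> nat \<Rightarrow> nat \<Rightarrow> (nat \<Rightarrow> int) \<Rightarrow> (nat \<Rightarrow> int) \<Rightarrow> (nat \<Rightarrow> int) \<Rightarrow> real \<Rightarrow> real \<Rightarrow> real \<Rightarrow> real" where
  "circle_symbol r t s \<alpha> \<beta> \<gamma> \<delta> \<epsilon> x =
     (real (2 * r + s + 1) + \<delta> - cos_sum r \<alpha> x) * (real (2 * t + s + 1) + \<epsilon> - cos_sum t \<beta> x)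
       - cis_sum_sq s \<gamma> x"

lemma cis_sum_sq_eq:
  "of_real (cis_sum_sq s \<gamma> x) =
     (\<Sum>j = 1..s. cis (2 * pi * of_int (\<gamma> j) * x)) * (\<Sum>j = 1..s. cis (- (2 * pi * of_int (\<gamma> j) * x)))"
proof -
  have "(\<Sum>j = 1..s. cis (- (2 * pi * of_int (\<gamma> j) * x))) = cnj (\<Sum>j = 1..s. cis (2 * pi * of_int (\<gamma> j) * x))"
    by (simp add: cis_cnj)
  then show ?thesis
    by (simp only: complex_mult_cnj) (simp add: cis_sum_sq_def power2_eq_square)
qed

lemma cis_sum_sq_le: "cis_sum_sq s \<gamma> x \<le> real s * real s"
proof -
  let ?z = "\<Sum>j = 1..s. cis (2 * pi * of_int (\<gamma> j) * x)"
  have "cmod ?z \<le> (\<Sum>j = 1..s. cmod (cis (2 * pi * of_int (\<gamma> j) * x)))" by (rule norm_sum)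
  then have "cmod ?z \<le> real s" by simp
  then have "(cmod ?z)\<^sup>2 \<le> (real s)\<^sup>2" by (intro power_mono) auto
  moreover have "(cmod ?z)\<^sup>2 = cis_sum_sq s \<gamma> x"
    unfolding cmod_power2 by (simp add: cis_sum_sq_def power2_eq_square)
  ultimately show ?thesis by (simp add: power2_eq_square)
qed

lemma cos_sum_le: "cos_sum r \<alpha> x \<le> real (2 * r)"
proof -
  have "cos_sum r \<alpha> x \<le> (\<Sum>j = 1..r. 2 * 1)"
    unfolding cos_sum_def by (intro sum_mono mult_left_mono cos_le_one) auto
  then show ?thesis by simp
qed

text \<open>A cosine sum is at most its number of terms doubled, so each factor keeps at least
  \<open>s + 1\<close>, while the subtracted square is at most \<open>s * s\<close>.\<close>

lemma circle_symbol_pos: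
  assumes "0 \<le> \<delta>" "0 \<le> \<epsilon>"
  shows "0 < circle_symbol r t s \<alpha> \<beta> \<gamma> \<delta> \<epsilon> x"
proof -
  have "(real s + 1) * (real s + 1) \<le>
     (real (2 * r + s + 1) + \<delta> - cos_sum r \<alpha> x) * (real (2 * t + s + 1) + \<epsilon> - cos_sum t \<beta> x)"
    using cos_sum_le[of r \<alpha> x] cos_sum_le[of t \<beta> x] assms by (intro mult_mono) auto
  moreover have "real s * real s < (real s + 1) * (real s + 1)" by (simp add: algebra_simps)
  ultimately show ?thesis using cis_sum_sq_le[of s \<gamma> x] unfolding circle_symbol_def by linarith
qed

lemma twice_smooth_circle_symbol: "twice_smooth (circle_symbol r t s \<alpha> \<beta> \<gamma> \<delta> \<epsilon>)"
  unfolding circle_symbol_def cos_sum_def cis_sum_sq_def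
  by (intro twice_smooth_diff twice_smooth_mult twice_smooth_add twice_smooth_sum twice_smooth_const
      twice_smooth_cos twice_smooth_sin)

lemma circle_symbol_periodic: "circle_symbol r t s \<alpha> \<beta> \<gamma> \<delta> \<epsilon> 0 = circle_symbol r t s \<alpha> \<beta> \<gamma> \<delta> \<epsilon> 1"
proof -
  have "cos (2 * pi * of_int a) = 1" "sin (2 * pi * of_int a) = 0" for a :: int
    using cis_multiple_2pi[of "of_int a"] by (simp_all add: complex_eq_iff)
  then show ?thesis by (simp add: circle_symbol_def cos_sum_def cis_sum_sq_def)
qed

lemma laurent_on_circle:
  fixes x :: real
  defines "z \<equiv> exp (2 * of_real pi * \<i> * of_real x)"
  shows "lpA r s \<alpha> z = of_real (real (2 * r + s + 1) - cos_sum r \<alpha> x)"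
    "lpB t s \<beta> z = of_real (real (2 * t + s + 1) - cos_sum t \<beta> x)"
    "lpC s \<gamma> (inverse z) * lpC s \<gamma> z = of_real (cis_sum_sq s \<gamma> x)"
proof -
  have z: "z = cis (2 * pi * x)" unfolding z_def cis_conv_exp by (simp add: mult_ac)
  have pw: "z powi a = cis (2 * pi * of_int a * x)" for a
    unfolding z cis_power_int by (simp add: mult_ac)
  have pw': "inverse z powi a = cis (- (2 * pi * of_int a * x))" for a
    unfolding z cis_inverse cis_power_int by (simp add: mult_ac)
  have pm: "z powi a + z powi (- a) = of_real (2 * cos (2 * pi * of_int a * x))" for a
    unfolding pw by (simp add: complex_eq_iff)
  show "lpA r s \<alpha> z = of_real (real (2 * r + s + 1) - cos_sum r \<alpha> x)"
    "lpB t s \<beta> z = of_real (real (2 * t + s + 1) - cos_sum t \<beta> x)"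
    unfolding lpA_def lpB_def cos_sum_def pm by simp_all
  show "lpC s \<gamma> (inverse z) * lpC s \<gamma> z = of_real (cis_sum_sq s \<gamma> x)"
    unfolding lpC_def pw pw' cis_sum_sq_eq by (simp add: mult.commute)
qed

lemma P_on_circle:
  fixes x :: real
  defines "z \<equiv> exp (2 * of_real pi * \<i> * of_real x)"
  shows "P1 r t s \<alpha> \<beta> \<gamma> z = of_real (circle_symbol r t s \<alpha> \<beta> \<gamma> 0 0 x)"
    "P2 r t s \<alpha> \<beta> \<gamma> z = of_real (circle_symbol r t s \<alpha> \<beta> \<gamma> 2 0 x)"
    "P3 r t s \<alpha> \<beta> \<gamma> z = of_real (circle_symbol r t s \<alpha> \<beta> \<gamma> 0 2 x)"
    "P4 r t s \<alpha> \<beta> \<gamma> z = of_real (circle_symbol r t s \<alpha> \<beta> \<gamma> 2 2 x)"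
  unfolding P1_def P2_def P3_def P4_def z_def laurent_on_circle circle_symbol_def
  by (simp_all add: algebra_simps)

section \<open>The forest number as a product of symbol values\<close>

lemma zmod_char_eq_cis: "zmod_char n k d = cis (2 * pi * of_int d * (real k / real n))"
  by (simp add: zmod_char_def mult_ac)

text \<open>As every \<open>\<alpha> j\<close> lies strictly between 0 and \<open>n/2\<close>, its
  negative is represented by \<open>n - \<alpha> j\<close> strictly above \<open>n/2\<close>. So no
  two of the \<open>2 * r\<close> residues collide, and none is \<open>n/2\<close>.\<close>

lemma pm_residues_props:
  fixes n :: nat
  assumes inj: "inj_on \<alpha> {1..r}" and b: "\<forall>j\<in>{1..r}. 1 \<le> \<alpha> j \<and> 2 * \<alpha> j < int n"
  shows "mod_symmetric n (pm_residues n r \<alpha>)" "card (pm_residues n r \<alpha>) = 2 * r"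
    "char_sum n k (pm_residues n r \<alpha>) = of_real (cos_sum r \<alpha> (real k / real n))"
    "\<forall>d\<in>pm_residues n r \<alpha>. 2 * d \<noteq> int n"
proof -
  let ?J = "{1..r}"
  have m: "\<alpha> j mod int n = \<alpha> j" "(- \<alpha> j) mod int n = int n - \<alpha> j" if "j \<in> ?J" for j
  proof -
    have bj: "0 \<le> \<alpha> j" "\<alpha> j < int n" "0 \<le> int n - \<alpha> j" "int n - \<alpha> j < int n"
      using bspec[OF b that] by auto
    show "\<alpha> j mod int n = \<alpha> j" using bj by (intro mod_pos_pos_trivial)
    have "(- \<alpha> j) mod int n = (int n - \<alpha> j) mod int n"
      by (metis minus_mod_self1 uminus_add_conv_diff mod_add_self2 add.commute)
    also have "\<dots> = int n - \<alpha> j" using bj by (intro mod_pos_pos_trivial)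
    finally show "(- \<alpha> j) mod int n = int n - \<alpha> j" .
  qed
  have pm: "pm_residues n r \<alpha> = \<alpha> ` ?J \<union> (\<lambda>j. int n - \<alpha> j) ` ?J"
    unfolding pm_residues_def using m by auto
  have ne: "\<alpha> i \<noteq> int n - \<alpha> j" if "i \<in> ?J" "j \<in> ?J" for i j
    using bspec[OF b that(1)] bspec[OF b that(2)] by linarith
  have disj: "\<alpha> ` ?J \<inter> (\<lambda>j. int n - \<alpha> j) ` ?J = {}"
  proof (rule equals0I)
    fix x assume "x \<in> \<alpha> ` ?J \<inter> (\<lambda>j. int n - \<alpha> j) ` ?J"
    then obtain i j where "i \<in> ?J" "x = \<alpha> i" "j \<in> ?J" "x = int n - \<alpha> j"
      by (elim IntE imageE)
    then show False using ne[of i j] by metis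
  qed
  have inj': "inj_on (\<lambda>j. int n - \<alpha> j) ?J"
  proof (rule inj_onI)
    fix i j assume ij: "i \<in> ?J" "j \<in> ?J" "int n - \<alpha> i = int n - \<alpha> j"
    from ij(3) have "\<alpha> i = \<alpha> j" by linarith
    then show "i = j" by (rule inj_onD[OF inj _ ij(1,2)])
  qed
  show "card (pm_residues n r \<alpha>) = 2 * r"
    unfolding pm card_Un_disjoint[OF finite_imageI[OF finite_atLeastAtMost] finite_imageI[OF finite_atLeastAtMost] disj]
      card_image[OF inj] card_image[OF inj'] by simp
  show "\<forall>d\<in>pm_residues n r \<alpha>. 2 * d \<noteq> int n"
  proof -
    have "2 * \<alpha> j \<noteq> int n \<and> 2 * (int n - \<alpha> j) \<noteq> int n" if "j \<in> ?J" for j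
      using bspec[OF b that] by arith
    then show ?thesis unfolding pm by blast
  qed
  show "mod_symmetric n (pm_residues n r \<alpha>)"
    unfolding mod_symmetric_def
  proof
    show "pm_residues n r \<alpha> \<subseteq> {1..<int n}"
    proof -
      have "\<alpha> j \<in> {1..<int n} \<and> int n - \<alpha> j \<in> {1..<int n}" if "j \<in> ?J" for j
        using bspec[OF b that] by simp
      then show ?thesis unfolding pm by blast
    qed
    show "\<forall>d\<in>pm_residues n r \<alpha>. (- d) mod int n \<in> pm_residues n r \<alpha>"
    proof
      fix d assume "d \<in> pm_residues n r \<alpha>"
      then consider j where "j \<in> ?J" "d = \<alpha> j" | j where "j \<in> ?J" "d = int n - \<alpha> j"
        unfolding pm by auto
      then show "(- d) mod int n \<in> pm_residues n r \<alpha>"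
      proof cases
        case 1
        then show ?thesis unfolding pm using m(2) by auto
      next
        case 2
        then have "(- d) mod int n = \<alpha> j" using m(1)[of j] by simp
        then show ?thesis unfolding pm using 2 by auto
      qed
    qed
  qed
  have "char_sum n k (pm_residues n r \<alpha>)
      = (\<Sum>j\<in>?J. zmod_char n k (\<alpha> j)) + (\<Sum>j\<in>?J. zmod_char n k (int n - \<alpha> j))"
    unfolding char_sum_def pm
      sum.union_disjoint[OF finite_imageI[OF finite_atLeastAtMost] finite_imageI[OF finite_atLeastAtMost] disj]
      sum.reindex[OF inj] sum.reindex[OF inj'] comp_def ..
  also have "(\<Sum>j\<in>?J. zmod_char n k (int n - \<alpha> j)) = (\<Sum>j\<in>?J. zmod_char n k (- \<alpha> j))"
  proof (rule sum.cong[OF refl])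
    fix j assume j: "j \<in> ?J"
    then have "0 < n" using bspec[OF b j] by linarith
    then show "zmod_char n k (int n - \<alpha> j) = zmod_char n k (- \<alpha> j)"
      using zmod_char_mod[of n k "- \<alpha> j"] m(2)[OF j] by simp
  qed
  also have "(\<Sum>j\<in>?J. zmod_char n k (\<alpha> j)) + (\<Sum>j\<in>?J. zmod_char n k (- \<alpha> j))
      = (\<Sum>j\<in>?J. of_real (2 * cos (2 * pi * of_int (\<alpha> j) * (real k / real n))))"
    unfolding sum.distrib[symmetric] zmod_char_eq_cis by (rule sum.cong) (simp_all add: complex_eq_iff)
  finally show "char_sum n k (pm_residues n r \<alpha>) = of_real (cos_sum r \<alpha> (real k / real n))"
    by (simp add: cos_sum_def)
qed

lemma residues_of_props:
  fixes n :: nat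
  assumes inj: "inj_on \<gamma> {1..s}" and b: "\<forall>j\<in>{1..s}. 0 \<le> \<gamma> j \<and> \<gamma> j < int n"
  shows "residues_of n s \<gamma> \<subseteq> {0..<int n}" "card (residues_of n s \<gamma>) = s"
    "char_sum n k (residues_of n s \<gamma>) * (\<Sum>d\<in>residues_of n s \<gamma>. zmod_char n k (- d))
       = of_real (cis_sum_sq s \<gamma> (real k / real n))"
proof -
  have r: "residues_of n s \<gamma> = \<gamma> ` {1..s}"
    unfolding residues_of_def using b by (intro image_cong mod_pos_pos_trivial) auto
  show "residues_of n s \<gamma> \<subseteq> {0..<int n}" unfolding r using b by auto
  show "card (residues_of n s \<gamma>) = s" unfolding r using card_image[OF inj] by simp
  show "char_sum n k (residues_of n s \<gamma>) * (\<Sum>d\<in>residues_of n s \<gamma>. zmod_char n k (- d))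
       = of_real (cis_sum_sq s \<gamma> (real k / real n))"
    unfolding r char_sum_def cis_sum_sq_eq sum.reindex[OF inj] comp_def zmod_char_eq_cis by simp
qed

lemma add_half_props:
  fixes n :: nat
  assumes n: "0 < n" "even n" and R: "mod_symmetric n R" "\<forall>d\<in>R. 2 * d \<noteq> int n"
  shows "mod_symmetric n (R \<union> {int n div 2})" "card (R \<union> {int n div 2}) = card R + 1"
    "char_sum n k (R \<union> {int n div 2}) = char_sum n k R + (-1) ^ k"
proof -
  obtain m where m: "n = 2 * m" using n by auto
  have h: "int n div 2 = int m" by (simp add: m)
  have nR: "int m \<notin> R" using R(2) m by auto
  have fin: "finite R" using R(1) unfolding mod_symmetric_def using finite_subset by blast
  have "(- int m) mod (2 * int m) = (2 * int m - int m) mod (2 * int m)"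
    using mod_add_self1[of "2 * int m" "- int m"] by simp
  then have "(- int m) mod int n = int m" using n m by simp
  then show "mod_symmetric n (R \<union> {int n div 2})"
    using R(1) n m unfolding h mod_symmetric_def by auto
  show "card (R \<union> {int n div 2}) = card R + 1" using nR fin by (simp add: h)
  have "zmod_char n k (int m) = cis (real k * pi)" using n m by (simp add: zmod_char_def field_simps)
  also have "\<dots> = (-1) ^ k" using Complex.DeMoivre[of pi k, symmetric] by (simp only: cis_pi)
  finally show "char_sum n k (R \<union> {int n div 2}) = char_sum n k R + (-1) ^ k"
    using nR fin by (simp add: h char_sum_def)
qed

lemma pm_residues_half_factor:
  fixes n :: nat
  assumes n: "0 < n" and p: "p \<longrightarrow> even n"
    and inj: "inj_on \<alpha> {1..r}" and b: "\<forall>j\<in>{1..r}. 1 \<le> \<alpha> j \<and> 2 * \<alpha> j < int n"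
  defines "R \<equiv> pm_residues n r \<alpha> \<union> (if p then {int n div 2} else {})"
  shows "mod_symmetric n R"
    "of_nat (card R + s + 1) - char_sum n k R =
       of_real (real (2 * r + s + 1) + (if p \<and> odd k then 2 else 0) - cos_sum r \<alpha> (real k / real n))"
proof -
  note P = pm_residues_props[OF inj b]
  note H = add_half_props[OF n mp[OF p] P(1,4)]
  show "mod_symmetric n R" using P(1) H(1) by (cases p) (simp_all add: R_def)
  show "of_nat (card R + s + 1) - char_sum n k R =
       of_real (real (2 * r + s + 1) + (if p \<and> odd k then 2 else 0) - cos_sum r \<alpha> (real k / real n))"
  proof (cases p)
    case True
    then have "R = pm_residues n r \<alpha> \<union> {int n div 2}" by (simp add: R_def)
    \<comment> \<open>The degree grows by 1 and the character sum by \<open>(-1) ^ k\<close>: they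
      cancel for even \<open>k\<close> and add up to 2 for odd \<open>k\<close>.\<close>
    then show ?thesis using H(2,3)[OF True] P(2,3) True by (cases "even k") simp_all
  next
    case False
    then show ?thesis using P(2,3) by (simp add: R_def)
  qed
qed

text \<open>The flags \<open>p\<close> and \<open>q\<close> say whether the involution is present in
  each layer, so one formula covers all four graphs.\<close>

lemma num_forests_eq_prod:
  fixes n :: nat
  assumes n: "0 < n" and pq: "p \<or> q \<longrightarrow> even n"
    and \<alpha>: "inj_on \<alpha> {1..r}" "\<forall>j\<in>{1..r}. 1 \<le> \<alpha> j \<and> 2 * \<alpha> j < int n"
    and \<beta>: "inj_on \<beta> {1..t}" "\<forall>j\<in>{1..t}. 1 \<le> \<beta> j \<and> 2 * \<beta> j < int n"
    and \<gamma>: "inj_on \<gamma> {1..s}" "\<forall>j\<in>{1..s}. 0 \<le> \<gamma> j \<and> \<gamma> j < int n"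
  shows "real (num_rooted_spanning_forests (bicirculant n
        (pm_residues n r \<alpha> \<union> (if p then {int n div 2} else {}))
        (pm_residues n t \<beta> \<union> (if q then {int n div 2} else {})) (residues_of n s \<gamma>))) =
    (\<Prod>k<n. circle_symbol r t s \<alpha> \<beta> \<gamma> (if p \<and> odd k then 2 else 0) (if q \<and> odd k then 2 else 0) (real k / real n))"
proof -
  have p: "p \<longrightarrow> even n" and q: "q \<longrightarrow> even n" using pq by auto
  note R = pm_residues_half_factor[OF n p \<alpha>] and T = pm_residues_half_factor[OF n q \<beta>]
  note S = residues_of_props[OF \<gamma>]
  let ?N = "num_rooted_spanning_forests (bicirculant n
        (pm_residues n r \<alpha> \<union> (if p then {int n div 2} else {}))
        (pm_residues n t \<beta> \<union> (if q then {int n div 2} else {})) (residues_of n s \<gamma>))"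
  have "complex_of_real (real ?N) = complex_of_nat ?N" by simp
  also have "\<dots> = (\<Prod>k = 0..<n. of_real (circle_symbol r t s \<alpha> \<beta> \<gamma>
      (if p \<and> odd k then 2 else 0) (if q \<and> odd k then 2 else 0) (real k / real n)))"
    by (subst num_rooted_spanning_forests_bicirculant[OF n R(1) T(1) S(1)], rule prod.cong[OF refl])
       (simp only: S(2,3) R(2) T(2) circle_symbol_def of_real_diff of_real_mult)
  also have "\<dots> = complex_of_real (\<Prod>k<n. circle_symbol r t s \<alpha> \<beta> \<gamma>
      (if p \<and> odd k then 2 else 0) (if q \<and> odd k then 2 else 0) (real k / real n))"
    by (simp only: of_real_prod lessThan_atLeast0)
  finally show ?thesis by (simp only: of_real_eq_iff)
qed

section \<open>Passage to the limit\<close>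

text \<open>For \<open>n = 2 * m\<close>, even frequencies give the nodes \<open>j/m\<close> and odd
  ones the nodes \<open>(j + 1/2)/m\<close>.\<close>

lemma prod_even_odd: "(\<Prod>k<2 * m. f k) = (\<Prod>j<m. f (2 * j)) * (\<Prod>j<m. f (2 * j + 1))" for f :: "nat \<Rightarrow> real"
  by (induction m) (simp_all add: mult_ac)

lemma circle_symbol_prods:
  fixes r t s :: nat and \<alpha> \<beta> \<gamma> :: "nat \<Rightarrow> int" and \<delta> \<epsilon> :: real
  assumes "0 \<le> \<delta>" "0 \<le> \<epsilon>"
  defines "g \<equiv> circle_symbol r t s \<alpha> \<beta> \<gamma> \<delta> \<epsilon>"
  shows "(\<lambda>m. (\<Prod>k<m. g (real k / m)) / exp (integral {0..1} (\<lambda>x. ln (g x))) ^ m) \<longlonglongrightarrow> 1"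
    "(\<lambda>m. (\<Prod>k<m. g ((real k + 1 / 2) / m)) / exp (integral {0..1} (\<lambda>x. ln (g x))) ^ m) \<longlonglongrightarrow> 1"
    "(\<lambda>x. ln (g x)) integrable_on {0..1}"
proof -
  have pos: "0 < g x" for x unfolding g_def by (rule circle_symbol_pos[OF assms(1,2)])
  have sm: "twice_smooth (\<lambda>x. ln (g x))"
    using twice_smooth_ln[OF twice_smooth_circle_symbol] pos unfolding g_def by blast
  show "(\<lambda>m. (\<Prod>k<m. g (real k / m)) / exp (integral {0..1} (\<lambda>x. ln (g x))) ^ m) \<longlonglongrightarrow> 1"
    by (rule prod_over_exp_tendsto[OF pos periodic_sum_tendsto[OF sm]])
       (simp add: g_def circle_symbol_periodic)
  show "(\<lambda>m. (\<Prod>k<m. g ((real k + 1 / 2) / m)) / exp (integral {0..1} (\<lambda>x. ln (g x))) ^ m) \<longlonglongrightarrow> 1"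
    by (rule prod_over_exp_tendsto[OF pos midpoint_sum_tendsto[OF sm]])
  show "(\<lambda>x. ln (g x)) integrable_on {0..1}"
    by (rule integrable_continuous_real[OF twice_smooth_continuous[OF sm]])
qed

lemma asymp_along_even:
  assumes H: "H \<longlonglongrightarrow> 1" and N: "\<And>m. 2 * m \<in> N \<Longrightarrow> f (2 * m) / g (2 * m) = H m" "\<And>n. n \<in> N \<Longrightarrow> even n"
  shows "asymp_along N f g"
proof -
  have "filterlim (\<lambda>n::nat. n div 2) at_top at_top"
    unfolding filterlim_at_top
  proof
    show "\<forall>\<^sub>F n in sequentially. Z \<le> n div 2" for Z :: nat
      by (rule eventually_sequentiallyI[of "2 * Z"]) auto
  qed
  then have "((\<lambda>n. H (n div 2)) \<longlongrightarrow> 1) (inf at_top (principal N))"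
    by (intro tendsto_mono[OF inf_le1] filterlim_compose[OF H])
  moreover have "\<forall>\<^sub>F n in inf at_top (principal N). H (n div 2) = f n / g n"
    unfolding eventually_inf_principal
  proof (intro always_eventually allI impI)
    fix n assume n: "n \<in> N"
    then obtain m where "n = 2 * m" using N(2) by blast
    then show "H (n div 2) = f n / g n" using N(1)[of m] n by simp
  qed
  ultimately show ?thesis unfolding asymp_along_def by (rule Lim_transform_eventually)
qed

text \<open>Admissibility bounds only the last term of each sequence; monotonicity passes the bound
  to the others.\<close>

lemma admissible_order_bounds:
  assumes "strict_mono_on {1..r} \<alpha>" and "\<forall>j\<in>{1..r}. 1 \<le> \<alpha> j"
    and "strict_mono_on {1..t} \<beta>" and "\<forall>j\<in>{1..t}. 1 \<le> \<beta> j"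
    and "strict_mono_on {1..s} \<gamma>" and "\<forall>j\<in>{1..s}. 0 \<le> \<gamma> j"
    and ad: "admissible_order r t s \<alpha> \<beta> \<gamma> n"
  shows "0 < n" "\<forall>j\<in>{1..r}. 1 \<le> \<alpha> j \<and> 2 * \<alpha> j < int n" "\<forall>j\<in>{1..t}. 1 \<le> \<beta> j \<and> 2 * \<beta> j < int n"
    "\<forall>j\<in>{1..s}. 0 \<le> \<gamma> j \<and> \<gamma> j < int n"
proof -
  have le: "f j \<le> f l" if "strict_mono_on {1..l} f" "j \<in> {1..l}" for f :: "nat \<Rightarrow> int" and j l
    using that strict_mono_on_leD[of "{1..l}" f j l] by simp
  show "0 < n" using ad by (simp add: admissible_order_def)
  have half: "\<forall>j\<in>{1..l}. 1 \<le> f j \<and> 2 * f j < int n"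
    if "strict_mono_on {1..l} f" "\<forall>j\<in>{1..l}. 1 \<le> f j" "0 < l \<longrightarrow> real_of_int (f l) < real n / 2"
    for f :: "nat \<Rightarrow> int" and l
  proof
    fix j assume j: "j \<in> {1..l}"
    then have "real_of_int (f l) < real n / 2" using that(3) by simp
    then have "2 * f l < int n" by linarith
    then show "1 \<le> f j \<and> 2 * f j < int n" using le[OF that(1) j] bspec[OF that(2) j] by linarith
  qed
  show "\<forall>j\<in>{1..r}. 1 \<le> \<alpha> j \<and> 2 * \<alpha> j < int n" "\<forall>j\<in>{1..t}. 1 \<le> \<beta> j \<and> 2 * \<beta> j < int n"
    using half[OF assms(1,2)] half[OF assms(3,4)] ad by (simp_all add: admissible_order_def)
  show "\<forall>j\<in>{1..s}. 0 \<le> \<gamma> j \<and> \<gamma> j < int n"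
  proof
    fix j assume j: "j \<in> {1..s}"
    then have "\<gamma> s \<le> int n - 1" using ad by (simp add: admissible_order_def)
    then show "0 \<le> \<gamma> j \<and> \<gamma> j < int n" using le[OF assms(5) j] bspec[OF assms(6) j] by linarith
  qed
qed

text \<open>\<open>P\<close> enters only through its values on the circle, which lets the same
  argument serve $P_2$, $P_3$ and $P_4$. Even frequencies always see the unshifted symbol of $P_1$,
  hence the second factor of the Mahler measure.\<close>

lemma asymp_half_case:
  fixes p q :: bool
  defines "\<delta> \<equiv> (if p then 2 else 0 :: real)" and "\<epsilon> \<equiv> (if q then 2 else 0 :: real)"
  assumes seqs: "strict_mono_on {1..r} \<alpha>" "\<forall>j\<in>{1..r}. 1 \<le> \<alpha> j"
      "strict_mono_on {1..t} \<beta>" "\<forall>j\<in>{1..t}. 1 \<le> \<beta> j"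
      "strict_mono_on {1..s} \<gamma>" "\<forall>j\<in>{1..s}. 0 \<le> \<gamma> j"
    and N: "\<And>n. n \<in> N \<Longrightarrow> admissible_order r t s \<alpha> \<beta> \<gamma> n \<and> even n"
    and P: "\<And>x::real. P (exp (2 * of_real pi * \<i> * of_real x)) = of_real (circle_symbol r t s \<alpha> \<beta> \<gamma> \<delta> \<epsilon> x)"
  shows "asymp_along N
     (\<lambda>n. real (num_rooted_spanning_forests (bicirculant n
        (pm_residues n r \<alpha> \<union> (if p then {int n div 2} else {}))
        (pm_residues n t \<beta> \<union> (if q then {int n div 2} else {})) (residues_of n s \<gamma>))))
     (\<lambda>n. mahler_measure (\<lambda>z. P z * P1 r t s \<alpha> \<beta> \<gamma> z) powr (real n / 2))"
proof -
  let ?g = "circle_symbol r t s \<alpha> \<beta> \<gamma>"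
  define I where "I \<delta> \<epsilon> = integral {0..1} (\<lambda>x. ln (?g \<delta> \<epsilon> x))" for \<delta> \<epsilon>
  have nn: "0 \<le> \<delta>" "0 \<le> \<epsilon>" by (simp_all add: \<delta>_def \<epsilon>_def)
  note L = circle_symbol_prods[where \<delta> = 0 and \<epsilon> = 0, of r t s \<alpha> \<beta> \<gamma>, simplified]
    and L' = circle_symbol_prods[OF nn, of r t s \<alpha> \<beta> \<gamma>]
  have pos: "0 < ?g \<delta> \<epsilon> x" "0 < ?g 0 0 x" for x using circle_symbol_pos nn by simp_all
  \<comment> \<open>Positivity of both symbols removes the modulus and splits the logarithm of the
    product.\<close>
  have "integral {0..1} (\<lambda>x. ln (cmod (P (exp (2 * of_real pi * \<i> * of_real x)) *
      P1 r t s \<alpha> \<beta> \<gamma> (exp (2 * of_real pi * \<i> * of_real x)))))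
      = integral {0..1} (\<lambda>x. ln (?g \<delta> \<epsilon> x) + ln (?g 0 0 x))"
    by (intro integral_cong)
       (simp add: P P_on_circle norm_mult abs_of_pos[OF pos(1)] abs_of_pos[OF pos(2)] ln_mult_pos[OF pos(1,2)])
  also have "\<dots> = I \<delta> \<epsilon> + I 0 0"
    unfolding I_def by (rule integral_add[OF L'(3) L(3)])
  finally have M: "mahler_measure (\<lambda>z. P z * P1 r t s \<alpha> \<beta> \<gamma> z) = exp (I \<delta> \<epsilon>) * exp (I 0 0)"
    by (simp add: mahler_measure_def exp_add)
  show ?thesis
  proof (rule asymp_along_even)
    show "(\<lambda>m. ((\<Prod>k<m. ?g 0 0 (real k / m)) / exp (I 0 0) ^ m) *
        ((\<Prod>k<m. ?g \<delta> \<epsilon> ((real k + 1 / 2) / m)) / exp (I \<delta> \<epsilon>) ^ m)) \<longlonglongrightarrow> 1"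
      using tendsto_mult[OF L(1) L'(2)] unfolding I_def by simp
  next
    fix m assume m: "2 * m \<in> N"
    note ab = admissible_order_bounds[OF seqs conjunct1[OF N[OF m]]]
    have inj: "inj_on \<alpha> {1..r}" "inj_on \<beta> {1..t}" "inj_on \<gamma> {1..s}"
      using seqs strict_mono_on_imp_inj_on by blast+
    have "real (num_rooted_spanning_forests (bicirculant (2 * m)
        (pm_residues (2 * m) r \<alpha> \<union> (if p then {int (2 * m) div 2} else {}))
        (pm_residues (2 * m) t \<beta> \<union> (if q then {int (2 * m) div 2} else {})) (residues_of (2 * m) s \<gamma>)))
      = (\<Prod>k<2 * m. ?g (if p \<and> odd k then 2 else 0) (if q \<and> odd k then 2 else 0) (real k / real (2 * m)))"
      by (rule num_forests_eq_prod[OF ab(1) _ inj(1) ab(2) inj(2) ab(3) inj(3) ab(4)]) simp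
    also have "\<dots> = (\<Prod>j<m. ?g 0 0 (real j / m)) * (\<Prod>j<m. ?g \<delta> \<epsilon> ((real j + 1 / 2) / m))"
    proof -
      have "real (2 * j) / real (2 * m) = real j / m" for j by simp
      moreover have "real (2 * j + 1) / real (2 * m) = (real j + 1 / 2) / m" for j
        by (simp add: field_simps)
      ultimately show ?thesis unfolding prod_even_odd \<delta>_def \<epsilon>_def by simp
    qed
    moreover have "(exp (I \<delta> \<epsilon>) * exp (I 0 0)) powr (real (2 * m) / 2) = exp (I 0 0) ^ m * exp (I \<delta> \<epsilon>) ^ m"
      by (simp add: powr_realpow power_mult_distrib mult.commute)
    ultimately show "real (num_rooted_spanning_forests (bicirculant (2 * m)
        (pm_residues (2 * m) r \<alpha> \<union> (if p then {int (2 * m) div 2} else {}))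
        (pm_residues (2 * m) t \<beta> \<union> (if q then {int (2 * m) div 2} else {})) (residues_of (2 * m) s \<gamma>))) /
       mahler_measure (\<lambda>z. P z * P1 r t s \<alpha> \<beta> \<gamma> z) powr (real (2 * m) / 2) =
      ((\<Prod>k<m. ?g 0 0 (real k / m)) / exp (I 0 0) ^ m) *
        ((\<Prod>k<m. ?g \<delta> \<epsilon> ((real k + 1 / 2) / m)) / exp (I \<delta> \<epsilon>) ^ m)"
      unfolding M by simp
  qed (use N in blast)
qed

text \<open>All frequencies carry the same symbol, so the periodic sum with \<open>n\<close> nodes
  suffices, and its limit is restricted to \<open>N\<close>.\<close>

lemma asymp_Gamma1:
  assumes seqs: "strict_mono_on {1..r} \<alpha>" "\<forall>j\<in>{1..r}. 1 \<le> \<alpha> j"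
      "strict_mono_on {1..t} \<beta>" "\<forall>j\<in>{1..t}. 1 \<le> \<beta> j"
      "strict_mono_on {1..s} \<gamma>" "\<forall>j\<in>{1..s}. 0 \<le> \<gamma> j"
    and N: "\<And>n. n \<in> N \<Longrightarrow> admissible_order r t s \<alpha> \<beta> \<gamma> n"
  shows "asymp_along N (\<lambda>n. real (num_rooted_spanning_forests (Gamma1 r t s \<alpha> \<beta> \<gamma> n)))
    (\<lambda>n. mahler_measure (P1 r t s \<alpha> \<beta> \<gamma>) ^ n)"
proof -
  let ?g = "circle_symbol r t s \<alpha> \<beta> \<gamma> 0 0"
  let ?I = "integral {0..1} (\<lambda>x. ln (?g x))"
  note L = circle_symbol_prods[where \<delta> = 0 and \<epsilon> = 0, of r t s \<alpha> \<beta> \<gamma>, simplified]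
  have M: "mahler_measure (P1 r t s \<alpha> \<beta> \<gamma>) = exp ?I"
    unfolding mahler_measure_def P_on_circle using circle_symbol_pos[of 0 0 r t s \<alpha> \<beta> \<gamma>]
    by (simp add: abs_of_pos)
  have inj: "inj_on \<alpha> {1..r}" "inj_on \<beta> {1..t}" "inj_on \<gamma> {1..s}"
    using seqs strict_mono_on_imp_inj_on by blast+
  have "((\<lambda>n. (\<Prod>k<n. ?g (real k / n)) / exp ?I ^ n) \<longlongrightarrow> 1) (inf at_top (principal N))"
    by (rule tendsto_mono[OF inf_le1 L(1)])
  moreover have "\<forall>\<^sub>F n in inf at_top (principal N). (\<Prod>k<n. ?g (real k / n)) / exp ?I ^ n =
      real (num_rooted_spanning_forests (Gamma1 r t s \<alpha> \<beta> \<gamma> n)) / mahler_measure (P1 r t s \<alpha> \<beta> \<gamma>) ^ n"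
    unfolding eventually_inf_principal
  proof (intro always_eventually allI impI)
    fix n assume n: "n \<in> N"
    note ab = admissible_order_bounds[OF seqs N[OF n]]
    show "(\<Prod>k<n. ?g (real k / n)) / exp ?I ^ n =
      real (num_rooted_spanning_forests (Gamma1 r t s \<alpha> \<beta> \<gamma> n)) / mahler_measure (P1 r t s \<alpha> \<beta> \<gamma>) ^ n"
      using num_forests_eq_prod[OF ab(1) _ inj(1) ab(2) inj(2) ab(3) inj(3) ab(4), of False False]
      unfolding M Gamma1_def by simp
  qed
  ultimately show ?thesis unfolding asymp_along_def by (rule Lim_transform_eventually)
qed

theorem theorem5p1:
  fixes r t s :: nat and \<alpha> \<beta> \<gamma> :: "nat \<Rightarrow> int"
  assumes "strict_mono_on {1..r} \<alpha>" and "\<forall>j\<in>{1..r}. 1 \<le> \<alpha> j"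
    and "strict_mono_on {1..t} \<beta>" and "\<forall>j\<in>{1..t}. 1 \<le> \<beta> j"
    and "strict_mono_on {1..s} \<gamma>" and "\<forall>j\<in>{1..s}. 0 \<le> \<gamma> j"
  shows
    "asymp_along
       {n. admissible_order r t s \<alpha> \<beta> \<gamma> n \<and> connected_graph (Gamma1 r t s \<alpha> \<beta> \<gamma> n)}
       (\<lambda>n. real (num_rooted_spanning_forests (Gamma1 r t s \<alpha> \<beta> \<gamma> n)))
       (\<lambda>n. mahler_measure (P1 r t s \<alpha> \<beta> \<gamma>) ^ n)
     \<and>
     asymp_along
       {n. admissible_order r t s \<alpha> \<beta> \<gamma> n \<and> even n \<and> connected_graph (Gamma2 r t s \<alpha> \<beta> \<gamma> n)}
       (\<lambda>n. real (num_rooted_spanning_forests (Gamma2 r t s \<alpha> \<beta> \<gamma> n)))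
       (\<lambda>n. mahler_measure (\<lambda>z. P2 r t s \<alpha> \<beta> \<gamma> z * P1 r t s \<alpha> \<beta> \<gamma> z) powr (real n / 2))
     \<and>
     asymp_along
       {n. admissible_order r t s \<alpha> \<beta> \<gamma> n \<and> even n \<and> connected_graph (Gamma3 r t s \<alpha> \<beta> \<gamma> n)}
       (\<lambda>n. real (num_rooted_spanning_forests (Gamma3 r t s \<alpha> \<beta> \<gamma> n)))
       (\<lambda>n. mahler_measure (\<lambda>z. P3 r t s \<alpha> \<beta> \<gamma> z * P1 r t s \<alpha> \<beta> \<gamma> z) powr (real n / 2))
     \<and>
     asymp_along
       {n. admissible_order r t s \<alpha> \<beta> \<gamma> n \<and> even n \<and> connected_graph (Gamma4 r t s \<alpha> \<beta> \<gamma> n)}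
       (\<lambda>n. real (num_rooted_spanning_forests (Gamma4 r t s \<alpha> \<beta> \<gamma> n)))
       (\<lambda>n. mahler_measure (\<lambda>z. P4 r t s \<alpha> \<beta> \<gamma> z * P1 r t s \<alpha> \<beta> \<gamma> z) powr (real n / 2))"
proof -
  have G2: "asymp_along N (\<lambda>n. real (num_rooted_spanning_forests (Gamma2 r t s \<alpha> \<beta> \<gamma> n)))
       (\<lambda>n. mahler_measure (\<lambda>z. P2 r t s \<alpha> \<beta> \<gamma> z * P1 r t s \<alpha> \<beta> \<gamma> z) powr (real n / 2))"
    if "\<And>n. n \<in> N \<Longrightarrow> admissible_order r t s \<alpha> \<beta> \<gamma> n \<and> even n" for N
    using asymp_half_case[OF assms that, where p = True and q = False and P = "P2 r t s \<alpha> \<beta> \<gamma>"]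
    by (simp add: Gamma2_def P_on_circle)
  have G3: "asymp_along N (\<lambda>n. real (num_rooted_spanning_forests (Gamma3 r t s \<alpha> \<beta> \<gamma> n)))
       (\<lambda>n. mahler_measure (\<lambda>z. P3 r t s \<alpha> \<beta> \<gamma> z * P1 r t s \<alpha> \<beta> \<gamma> z) powr (real n / 2))"
    if "\<And>n. n \<in> N \<Longrightarrow> admissible_order r t s \<alpha> \<beta> \<gamma> n \<and> even n" for N
    using asymp_half_case[OF assms that, where p = False and q = True and P = "P3 r t s \<alpha> \<beta> \<gamma>"]
    by (simp add: Gamma3_def P_on_circle)
  have G4: "asymp_along N (\<lambda>n. real (num_rooted_spanning_forests (Gamma4 r t s \<alpha> \<beta> \<gamma> n)))
       (\<lambda>n. mahler_measure (\<lambda>z. P4 r t s \<alpha> \<beta> \<gamma> z * P1 r t s \<alpha> \<beta> \<gamma> z) powr (real n / 2))"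
    if "\<And>n. n \<in> N \<Longrightarrow> admissible_order r t s \<alpha> \<beta> \<gamma> n \<and> even n" for N
    using asymp_half_case[OF assms that, where p = True and q = True and P = "P4 r t s \<alpha> \<beta> \<gamma>"]
    by (simp add: Gamma4_def P_on_circle)
  show ?thesis
    by (intro conjI asymp_Gamma1[OF assms] G2 G3 G4) auto
qed

end
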